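(* Consider the generalized time-dependent Pólya urn process $(R_n,B_n)_{n\ge0}$ with non-decreasing weight function $w:\mathbb N\to(0,\infty)$ satisfying $\sum_{n\ge0}\frac1{w(n)}<\infty$, drawing sequence $(\sigma_n)_{n\ge1}$ of positive integers, and initial numbers $R_0,B_0\in\mathbb N$ of red and blue balls. Extend $w$ to $[0,\infty)$ by linear interpolation and let $\tau_n=R_0+B_0+\sigma_1+\dots+\sigma_n$. Assume that: (i) $\limsup_{n\to\infty}\sigma_n=\infty$; (ii) $\displaystyle\liminf_{n\to\infty}\frac{w(\frac{\tau_n}2+\sqrt{\sigma_n})}{w(\frac{\tau_n}2)}>1$; (iii) for any $\varepsilon\in(0,\frac12)$ there exists $n_0$ such that for all $n\ge n_0$, $$\sum_{i=n}^\infty\frac{\sigma_{i+1}}{w((\frac12+\varepsilon)\tau_i)}\le\frac14\sum_{i=\lfloor(\frac12-\varepsilon)\tau_n\rfloor}^\infty\frac1{w(i)}.$$ Then $$\mathbb P(R_\infty<\infty\text{ or }B_\infty<\infty)=1.$$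
   Context: $\mathbb N=\{0,1,2,\dots\}$. Generalized time-dependent Pólya urn (GPU) process: fix a non-decreasing $w:\mathbb N\to(0,\infty)$ and a sequence $(\sigma_n)_{n\ge1}$ of positive integers. The urn initially contains $R_0$ red and $B_0$ blue balls. At step $n+1$ ($n\ge0$), $\sigma_{n+1}$ new balls are added simultaneously, each being, independently, red with probability $\frac{w(R_n)}{w(R_n)+w(B_n)}$ and blue otherwise, where $R_n,B_n$ are the numbers of red and blue balls after $n$ steps. That is, conditionally on the past up to step $n$, $R_{n+1}-R_n$ is Binomial with parameters $\sigma_{n+1}$ and $\frac{w(R_n)}{w(R_n)+w(B_n)}$, and $B_{n+1}-B_n=\sigma_{n+1}-(R_{n+1}-R_n)$; hence $R_n+B_n=\tau_n$. Set $R_\infty=\lim_n R_n$ and $B_\infty=\lim_n B_n$ in $\mathbb N\cup\{\infty\}$. *)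

theory Defs
  imports "HOL-Probability.Probability"
begin

text \<open>
  The numbers of balls added are \<open>\<sigma> 1, \<sigma> 2, \<dots>\<close>; the value \<open>\<sigma> 0\<close> is never used by the process.
\<close>

definition total_balls :: "nat \<Rightarrow> nat \<Rightarrow> (nat \<Rightarrow> nat) \<Rightarrow> nat \<Rightarrow> nat" where
  "total_balls r0 b0 \<sigma> n = r0 + b0 + (\<Sum>i=1..n. \<sigma> i)"

text \<open>Linear interpolation of a function on the naturals; only used at arguments \<open>x \<ge> 0\<close>.\<close>

definition lin_interp :: "(nat \<Rightarrow> real) \<Rightarrow> real \<Rightarrow> real" where
  "lin_interp w x =
     w (nat \<lfloor>x\<rfloor>) + (x - real (nat \<lfloor>x\<rfloor>)) * (w (Suc (nat \<lfloor>x\<rfloor>)) - w (nat \<lfloor>x\<rfloor>))"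

text \<open>
  In \<open>step_law\<close>, the past up to step \<open>n\<close> is the trajectory of both colours; since it takes countably
  many values, conditioning on it is conditioning on each trajectory \<open>(r, b)\<close> of positive
  probability. In \<open>step_total\<close>, the equation for the increment of \<open>B\<close> is written without
  subtraction, which would truncate on \<open>nat\<close>.
\<close>

locale gpu_process = prob_space M for M :: "'a measure" +
  fixes w :: "nat \<Rightarrow> real"
    and \<sigma> :: "nat \<Rightarrow> nat"
    and r0 b0 :: nat
    and R B :: "nat \<Rightarrow> 'a \<Rightarrow> nat"
  assumes w_mono: "mono w"
    and w_pos: "\<And>n. w n > 0"
    and \<sigma>_pos: "\<And>n. n \<ge> 1 \<Longrightarrow> \<sigma> n > 0"
    and R_measurable: "\<And>n. R n \<in> measurable M (count_space UNIV)"
    and B_measurable: "\<And>n. B n \<in> measurable M (count_space UNIV)"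
    and init: "AE \<omega> in M. R 0 \<omega> = r0 \<and> B 0 \<omega> = b0"
    and step_law: "\<And>n r b k.
      \<P>(\<omega> in M. \<forall>i\<le>n. R i \<omega> = r i \<and> B i \<omega> = b i) > 0 \<Longrightarrow>
      \<P>(\<omega> in M. R (Suc n) \<omega> = R n \<omega> + k \<bar> \<forall>i\<le>n. R i \<omega> = r i \<and> B i \<omega> = b i)
        = pmf (binomial_pmf (\<sigma> (Suc n)) (w (r n) / (w (r n) + w (b n)))) k"
    and step_total: "\<And>n. AE \<omega> in M.
      R (Suc n) \<omega> + B (Suc n) \<omega> = R n \<omega> + B n \<omega> + \<sigma> (Suc n)"

text \<open>
  The limit in \<open>\<nat> \<union> {\<infinity>}\<close> of a sequence of counts; it exists for almost every trajectory
  of the urn, since the counts are almost surely non-decreasing.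
\<close>

definition final_count :: "(nat \<Rightarrow> 'a \<Rightarrow> nat) \<Rightarrow> 'a \<Rightarrow> enat" where
  "final_count X \<omega> = lim (\<lambda>n. enat (X n \<omega>))"

end

theory Submission
  imports Defs
begin

text \<open>
  Let \<open>D n = (R n - B n) / 2\<close>. A single step with many balls has fluctuations of order
  \<open>sqrt (\<sigma> n)\<close>, so whatever the past, with probability bounded below the leading colour is ahead by
  \<open>sqrt (\<sigma> n)\<close> after it. By (ii) every ball is then of the leading colour with probability at least
  \<open>\<rho> / (1 + \<rho>)\<close> for a fixed \<open>\<rho> > 1\<close>, and as long as this persists \<open>\<rho> powr (- D n)\<close> decays
  geometrically in the number of balls. Hence with probability at least one half the leader stays ahead
  by \<open>sqrt (\<sigma> k)\<close> at all later times \<open>k\<close>, and then Borel--Cantelli gives \<open>D k \<ge> \<epsilon> * \<tau> k\<close> eventually.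
  A zero-one argument upgrades the uniform lower bound to: almost surely one colour dominates
  linearly. While red dominates linearly, the expected decrease of \<open>\<Sum>i\<ge>B n. 1 / w i\<close> in
  one step is at most \<open>\<sigma> (n + 1) / w ((1/2 + \<epsilon>) * \<tau> n)\<close>; by (iii) the total expected decrease is
  at most a quarter of the current value, so by Markov's inequality blue stays bounded with
  conditional probability at least \<open>3/4\<close>, and the same zero-one argument finishes the proof.
\<close>

subsection \<open>Conditioning on the past\<close>

text \<open>The integrand is the sum over \<open>x\<close> of \<open>f x\<close> times the indicator
  of \<open>X = x\<close>. The values of \<open>X\<close> form a countable discrete space, so the
  sum and the integral may be exchanged for an arbitrary \<open>f\<close>.\<close>

lemma nn_integral_countable_valued:
  fixes X :: "'a \<Rightarrow> 'c::countable"
  assumes X[measurable]: "X \<in> measurable M (count_space UNIV)" and A[measurable]: "A \<in> sets M"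
  shows "(\<integral>\<^sup>+\<omega>\<in>A. f (X \<omega>) \<partial>M)
    = (\<integral>\<^sup>+x. f x * emeasure M {\<omega>\<in>A. X \<omega> = x} \<partial>count_space UNIV)"
proof -
  have S[measurable]: "{\<omega>\<in>A. X \<omega> = x} \<in> sets M" for x
  proof -
    have "{\<omega>\<in>A. X \<omega> = x} = A \<inter> (X -` {x} \<inter> space M)" using sets.sets_into_space[OF A] by auto
    then show ?thesis using measurable_sets[OF X, of "{x}"] by auto
  qed
  have "(\<integral>\<^sup>+\<omega>\<in>A. f (X \<omega>) \<partial>M)
      = (\<integral>\<^sup>+\<omega>. \<integral>\<^sup>+x. f x * indicator {\<omega>\<in>A. X \<omega> = x} \<omega> \<partial>count_space UNIV \<partial>M)"
  proof (rule nn_integral_cong)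
    fix \<omega>
    have "(\<integral>\<^sup>+x. f x * indicator {\<omega>\<in>A. X \<omega> = x} \<omega> \<partial>count_space UNIV)
      = (\<integral>\<^sup>+x. (f x * indicator A \<omega>) * indicator {X \<omega>} x \<partial>count_space UNIV)"
      by (intro nn_integral_cong) (auto split: split_indicator)
    also have "\<dots> = f (X \<omega>) * indicator A \<omega>"
      by simp
    finally show "f (X \<omega>) * indicator A \<omega> =
        (\<integral>\<^sup>+x. f x * indicator {\<omega>\<in>A. X \<omega> = x} \<omega> \<partial>count_space UNIV)" ..
  qed
  also have "\<dots> = (\<integral>\<^sup>+x. \<integral>\<^sup>+\<omega>. f x * indicator {\<omega>\<in>A. X \<omega> = x} \<omega> \<partial>M \<partial>count_space UNIV)"
    by (rule nn_integral_count_space_nn_integral) auto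
  also have "\<dots> = (\<integral>\<^sup>+x. f x * emeasure M {\<omega>\<in>A. X \<omega> = x} \<partial>count_space UNIV)"
    by (intro nn_integral_cong nn_integral_cmult_indicator S)
  finally show ?thesis .
qed

context gpu_process
begin

lemmas count_measurable[measurable] = R_measurable B_measurable

lemma measurable_fun_state:
  "(\<lambda>\<omega>. f (R i \<omega>) (B i \<omega>) (R j \<omega>) (B j \<omega>)) \<in> measurable M (count_space UNIV)"
proof -
  have "(\<lambda>\<omega>. (R i \<omega>, B i \<omega>, R j \<omega>, B j \<omega>)) \<in> measurable M (count_space UNIV)"
    by measurable
  from measurable_compose[OF this measurable_count_space, of "\<lambda>(r, b, r', b'). f r b r' b'"]
  show ?thesis by simp
qed

lemma events_state: "{\<omega>\<in>space M. Q (R i \<omega>) (B i \<omega>) (R j \<omega>) (B j \<omega>)} \<in> events"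
  using measurable_sets[OF measurable_fun_state[of Q i j], of "{True}"]
  by (simp add: vimage_def Int_def conj_commute)

text \<open>This is the sigma-algebra generated by the first \<open>n\<close> steps, described by
  saturation: with an outcome the event contains every outcome of the same trajectory up to
  \<open>n\<close>. Both descriptions agree because there are only countably many such
  trajectories.\<close>

definition past :: "nat \<Rightarrow> 'a set \<Rightarrow> bool" where
  "past n A \<longleftrightarrow> A \<in> events \<and>
     (\<forall>\<omega>\<in>A. \<forall>\<omega>'\<in>space M. (\<forall>i\<le>n. R i \<omega> = R i \<omega>' \<and> B i \<omega> = B i \<omega>') \<longrightarrow> \<omega>' \<in> A)"

definition red_prob :: "nat \<Rightarrow> nat \<Rightarrow> real" where
  "red_prob r b = w r / (w r + w b)"

lemma red_prob_bounds: "0 < red_prob r b" "red_prob r b < 1"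
  using w_pos[of r] w_pos[of b] by (auto simp: red_prob_def field_simps)

lemma past_events: "past n A \<Longrightarrow> A \<in> events"
  by (simp add: past_def)

lemma past_mono: "past n A \<Longrightarrow> n \<le> m \<Longrightarrow> past m A"
  unfolding past_def by (meson order_trans)

lemma past_Int: "past n A \<Longrightarrow> past n A' \<Longrightarrow> past n (A \<inter> A')"
  unfolding past_def by blast

lemma past_space: "past n (space M)"
  unfolding past_def by simp

lemma past_Collect:
  assumes "{\<omega>\<in>space M. P \<omega>} \<in> events"
    and "\<And>\<omega> \<omega>'. (\<And>i. i \<le> n \<Longrightarrow> R i \<omega> = R i \<omega>' \<and> B i \<omega> = B i \<omega>') \<Longrightarrow> P \<omega> \<Longrightarrow> P \<omega>'"
  shows "past n {\<omega>\<in>space M. P \<omega>}"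
  using assms unfolding past_def by blast

text \<open>The event splits into countably many trajectories \<open>E l\<close> up to step
  \<open>n\<close>. On each of them \<open>step_law\<close> gives the same factor, because the law
  depends on the trajectory only through its last state \<open>(r, b)\<close>.\<close>

lemma emeasure_step:
  assumes A: "past n A"
  shows "emeasure M {\<omega>\<in>A. R n \<omega> = r \<and> B n \<omega> = b \<and> R (Suc n) \<omega> = r + k}
    = emeasure M {\<omega>\<in>A. R n \<omega> = r \<and> B n \<omega> = b}
      * ennreal (pmf (binomial_pmf (\<sigma> (Suc n)) (red_prob r b)) k)"
proof -
  define H where "H \<omega> = map (\<lambda>i. (R i \<omega>, B i \<omega>)) [0..<Suc n]" for \<omega>
  define L where "L = H ` {\<omega>\<in>A. R n \<omega> = r \<and> B n \<omega> = b}"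
  define E where "E l = {\<omega>\<in>space M. H \<omega> = l}" for l
  define C where "C = {\<omega>\<in>space M. R (Suc n) \<omega> = R n \<omega> + k}"
  define q where "q = pmf (binomial_pmf (\<sigma> (Suc n)) (red_prob r b)) k"
  have Aev: "A \<subseteq> space M" using sets.sets_into_space[OF past_events[OF A]] .
  have H_eq: "H \<omega> = H \<omega>' \<longleftrightarrow> (\<forall>i\<le>n. R i \<omega> = R i \<omega>' \<and> B i \<omega> = B i \<omega>')" for \<omega> \<omega>'
    by (auto simp: H_def list_eq_iff_nth_eq nth_append less_Suc_eq_le simp del: upt_Suc)
  have mE: "E l \<in> events" for l
  proof (cases "E l = {}")
    case False
    then obtain \<omega>' where "H \<omega>' = l" by (auto simp: E_def)
    then have "E l = {\<omega>\<in>space M. \<forall>i\<le>n. R i \<omega> = R i \<omega>' \<and> B i \<omega> = B i \<omega>'}"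
      using H_eq unfolding E_def by auto
    then show ?thesis by simp
  qed simp
  have mC: "C \<in> events" unfolding C_def
    using events_state[of "\<lambda>r _ r' _. r' = r + k" n "Suc n"] by simp
  have U: "{\<omega>\<in>A. R n \<omega> = r \<and> B n \<omega> = b} = (\<Union>l\<in>L. E l)"
  proof -
    have "\<omega> \<in> A \<and> R n \<omega> = r \<and> B n \<omega> = b"
      if "\<omega> \<in> space M" "H \<omega> = H \<omega>'" "\<omega>' \<in> A" "R n \<omega>' = r" "B n \<omega>' = b" for \<omega> \<omega>'
      using that A unfolding past_def H_eq by (metis order_refl)
    then show ?thesis using Aev unfolding L_def E_def by (auto simp: image_iff)
  qed
  have step: "emeasure M (E l \<inter> C) = emeasure M (E l) * ennreal q" if "l \<in> L" for l
  proof -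
    obtain \<omega>' where o: "\<omega>' \<in> A" "H \<omega>' = l" "R n \<omega>' = r" "B n \<omega>' = b"
      using \<open>l \<in> L\<close> by (auto simp: L_def)
    have E_alt: "E l = {\<omega>\<in>space M. \<forall>i\<le>n. R i \<omega> = R i \<omega>' \<and> B i \<omega> = B i \<omega>'}"
      using H_eq o unfolding E_def by auto
    \<comment> \<open>\<open>step_law\<close> speaks only of trajectories of positive probability; a
      null trajectory contributes zero to both sides.\<close>
    have "prob (E l \<inter> C) = prob (E l) * q"
    proof (cases "prob (E l) > 0")
      case True
      have "E l \<inter> C = {\<omega> \<in> space M. R (Suc n) \<omega> = R n \<omega> + k \<and> (\<forall>i\<le>n. R i \<omega> = R i \<omega>' \<and> B i \<omega> = B i \<omega>')}"
        by (auto simp: E_alt C_def)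
      then have "prob (E l \<inter> C) / prob (E l) = q"
        using step_law[of n "\<lambda>i. R i \<omega>'" "\<lambda>i. B i \<omega>'" k] True o
        by (simp add: cond_prob_def E_alt q_def red_prob_def)
      then show ?thesis using True by (simp add: field_simps)
    next
      case False
      then have "prob (E l) = 0" using measure_nonneg[of M "E l"] by linarith
      moreover have "prob (E l \<inter> C) \<le> prob (E l)" by (intro finite_measure_mono mE) auto
      ultimately show ?thesis using measure_nonneg[of M "E l \<inter> C"] by simp
    qed
    then show ?thesis by (simp add: emeasure_eq_measure ennreal_mult q_def)
  qed
  have disj: "disjoint_family_on E L" by (auto simp: disjoint_family_on_def E_def)
  have "emeasure M {\<omega>\<in>A. R n \<omega> = r \<and> B n \<omega> = b \<and> R (Suc n) \<omega> = r + k}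
      = emeasure M (\<Union>l\<in>L. E l \<inter> C)"
    using U Aev unfolding C_def by (intro arg_cong[where f="emeasure M"]) fastforce
  also have "\<dots> = (\<integral>\<^sup>+l. emeasure M (E l \<inter> C) \<partial>count_space L)"
    using mE mC disj by (intro emeasure_UN_countable) (auto simp: disjoint_family_on_def)
  also have "\<dots> = (\<integral>\<^sup>+l. emeasure M (E l) * ennreal q \<partial>count_space L)"
    using step by (intro nn_integral_cong) auto
  also have "\<dots> = (\<integral>\<^sup>+l. emeasure M (E l) \<partial>count_space L) * ennreal q"
    by (simp add: nn_integral_multc)
  also have "(\<integral>\<^sup>+l. emeasure M (E l) \<partial>count_space L) = emeasure M (\<Union>l\<in>L. E l)"
    using mE disj by (intro emeasure_UN_countable[symmetric]) auto
  finally show ?thesis unfolding U q_def .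
qed

text \<open>The restriction on the left is where the truncated difference
  \<open>R (Suc n) \<omega> - R n \<omega>\<close> is the true increment. That it holds almost
  surely is itself derived from this formula.\<close>

lemma nn_integral_step_ge:
  assumes A: "past n A"
  shows "(\<integral>\<^sup>+\<omega>\<in>{\<omega>\<in>A. R n \<omega> \<le> R (Suc n) \<omega>}. g (R n \<omega>) (B n \<omega>) (R (Suc n) \<omega> - R n \<omega>) \<partial>M)
    = (\<integral>\<^sup>+\<omega>\<in>A. (\<integral>\<^sup>+k. g (R n \<omega>) (B n \<omega>) k
          \<partial>binomial_pmf (\<sigma> (Suc n)) (red_prob (R n \<omega>) (B n \<omega>))) \<partial>M)"
proof -
  define A' where "A' = {\<omega>\<in>A. R n \<omega> \<le> R (Suc n) \<omega>}"
  define pm where "pm rb = binomial_pmf (\<sigma> (Suc n)) (red_prob (fst rb) (snd rb))" for rb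
  have Aev: "A \<in> events" "A \<subseteq> space M"
    using sets.sets_into_space past_events[OF A] by auto
  have A': "A' \<in> events"
  proof -
    have "A' = A \<inter> {\<omega>\<in>space M. R n \<omega> \<le> R (Suc n) \<omega>}" using Aev by (auto simp: A'_def)
    then show ?thesis using Aev events_state[of "\<lambda>r _ r' _. r \<le> r'" n "Suc n"] by (simp add: sets.Int)
  qed
  define X where "X \<omega> = (R n \<omega>, B n \<omega>)" for \<omega>
  define Y where "Y \<omega> = (X \<omega>, R (Suc n) \<omega> - R n \<omega>)" for \<omega>
  have X[measurable]: "X \<in> measurable M (count_space UNIV)"
    unfolding X_def by measurable
  have Y[measurable]: "Y \<in> measurable M (count_space UNIV)"
    unfolding Y_def X_def by measurable
  have "(\<integral>\<^sup>+\<omega>\<in>A'. g (R n \<omega>) (B n \<omega>) (R (Suc n) \<omega> - R n \<omega>) \<partial>M)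
      = (\<integral>\<^sup>+\<omega>\<in>A'. (case Y \<omega> of ((r,b),k) \<Rightarrow> g r b k) \<partial>M)"
    by (simp add: Y_def X_def)
  also have "\<dots> = (\<integral>\<^sup>+y. (case y of ((r,b),k) \<Rightarrow> g r b k) * emeasure M {\<omega>\<in>A'. Y \<omega> = y} \<partial>count_space UNIV)"
    by (rule nn_integral_countable_valued[OF Y A'])
  also have "\<dots> = (\<integral>\<^sup>+rb. \<integral>\<^sup>+k. g (fst rb) (snd rb) k * emeasure M {\<omega>\<in>A'. Y \<omega> = (rb,k)}
      \<partial>count_space UNIV \<partial>count_space UNIV)"
    by (subst nn_integral_fst_count_space[symmetric]) (simp add: case_prod_beta)
  also have "\<dots> = (\<integral>\<^sup>+rb. (\<integral>\<^sup>+k. g (fst rb) (snd rb) k \<partial>pm rb) * emeasure M {\<omega>\<in>A. X \<omega> = rb} \<partial>count_space UNIV)"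
  proof (rule nn_integral_cong)
    fix rb
    have "emeasure M {\<omega>\<in>A'. Y \<omega> = (rb,k)} = emeasure M {\<omega>\<in>A. X \<omega> = rb} * ennreal (pmf (pm rb) k)" for k
    proof -
      have "{\<omega>\<in>A'. Y \<omega> = (rb,k)} = {\<omega>\<in>A. R n \<omega> = fst rb \<and> B n \<omega> = snd rb \<and> R (Suc n) \<omega> = fst rb + k}"
        by (cases rb) (auto simp: A'_def Y_def X_def)
      moreover have "{\<omega>\<in>A. X \<omega> = rb} = {\<omega>\<in>A. R n \<omega> = fst rb \<and> B n \<omega> = snd rb}"
        by (cases rb) (auto simp: X_def)
      ultimately show ?thesis using emeasure_step[OF A] by (simp add: pm_def)
    qed
    then have "(\<integral>\<^sup>+k. g (fst rb) (snd rb) k * emeasure M {\<omega>\<in>A'. Y \<omega> = (rb,k)} \<partial>count_space UNIV)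
      = (\<integral>\<^sup>+k. (ennreal (pmf (pm rb) k) * g (fst rb) (snd rb) k) * emeasure M {\<omega>\<in>A. X \<omega> = rb} \<partial>count_space UNIV)"
      by (simp add: mult_ac)
    also have "\<dots> = (\<integral>\<^sup>+k. ennreal (pmf (pm rb) k) * g (fst rb) (snd rb) k \<partial>count_space UNIV) * emeasure M {\<omega>\<in>A. X \<omega> = rb}"
      by (rule nn_integral_multc) simp
    finally show "(\<integral>\<^sup>+k. g (fst rb) (snd rb) k * emeasure M {\<omega>\<in>A'. Y \<omega> = (rb,k)} \<partial>count_space UNIV)
      = (\<integral>\<^sup>+k. g (fst rb) (snd rb) k \<partial>pm rb) * emeasure M {\<omega>\<in>A. X \<omega> = rb}"
      by (simp add: nn_integral_measure_pmf)
  qed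
  also have "\<dots> = (\<integral>\<^sup>+\<omega>\<in>A. (\<integral>\<^sup>+k. g (fst (X \<omega>)) (snd (X \<omega>)) k \<partial>pm (X \<omega>)) \<partial>M)"
    by (rule nn_integral_countable_valued[OF X Aev(1), symmetric])
  finally show ?thesis by (simp add: A'_def X_def pm_def)
qed

text \<open>Taking the integrand to be 1, the binomial weights already sum to one over non-negative
  increments, so no mass is left for a decrease.\<close>

lemma AE_R_mono: "AE \<omega> in M. R n \<omega> \<le> R (Suc n) \<omega>"
proof -
  have "emeasure M {\<omega>\<in>space M. R n \<omega> \<le> R (Suc n) \<omega>} = 1"
    using nn_integral_step_ge[OF past_space[of n], of "\<lambda>_ _ _. 1"] events_state[of "\<lambda>r _ r' _. r \<le> r'" n "Suc n"]
    by (simp add: emeasure_space_1)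
  then have "prob {\<omega>\<in>space M. R n \<omega> \<le> R (Suc n) \<omega>} = 1"
    by (simp add: measure_def)
  then show ?thesis
    using events_state[of "\<lambda>r _ r' _. r \<le> r'" n "Suc n"] by (subst prob_Collect_eq_1[symmetric]) auto
qed

text \<open>The Markov property in integrated form. It takes the place of conditional expectations
  in every later one-step estimate; the new blue count is determined by the red one through
  \<open>step_total\<close>.\<close>

lemma nn_integral_step:
  assumes A: "past n A"
  shows "(\<integral>\<^sup>+\<omega>\<in>A. f (R n \<omega>) (B n \<omega>) (R (Suc n) \<omega>) (B (Suc n) \<omega>) \<partial>M)
    = (\<integral>\<^sup>+\<omega>\<in>A. (\<integral>\<^sup>+k. f (R n \<omega>) (B n \<omega>) (R n \<omega> + k) (B n \<omega> + \<sigma> (Suc n) - k)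
          \<partial>binomial_pmf (\<sigma> (Suc n)) (red_prob (R n \<omega>) (B n \<omega>))) \<partial>M)"
proof -
  have "(\<integral>\<^sup>+\<omega>\<in>A. f (R n \<omega>) (B n \<omega>) (R (Suc n) \<omega>) (B (Suc n) \<omega>) \<partial>M)
    = (\<integral>\<^sup>+\<omega>\<in>{\<omega>\<in>A. R n \<omega> \<le> R (Suc n) \<omega>}. f (R n \<omega>) (B n \<omega>) (R n \<omega> + (R (Suc n) \<omega> - R n \<omega>))
         (B n \<omega> + \<sigma> (Suc n) - (R (Suc n) \<omega> - R n \<omega>)) \<partial>M)"
  proof (rule nn_integral_cong_AE)
    show "AE \<omega> in M. f (R n \<omega>) (B n \<omega>) (R (Suc n) \<omega>) (B (Suc n) \<omega>) * indicator A \<omega>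
      = f (R n \<omega>) (B n \<omega>) (R n \<omega> + (R (Suc n) \<omega> - R n \<omega>))
         (B n \<omega> + \<sigma> (Suc n) - (R (Suc n) \<omega> - R n \<omega>)) * indicator {\<omega>\<in>A. R n \<omega> \<le> R (Suc n) \<omega>} \<omega>"
      using AE_R_mono[of n] step_total[of n]
    proof eventually_elim
      case (elim \<omega>)
      then have "B (Suc n) \<omega> = B n \<omega> + \<sigma> (Suc n) - (R (Suc n) \<omega> - R n \<omega>)" by linarith
      then show ?case using elim(1) by (simp add: indicator_def)
    qed
  qed
  also have "\<dots> = (\<integral>\<^sup>+\<omega>\<in>A. (\<integral>\<^sup>+k. f (R n \<omega>) (B n \<omega>) (R n \<omega> + k) (B n \<omega> + \<sigma> (Suc n) - k)
          \<partial>binomial_pmf (\<sigma> (Suc n)) (red_prob (R n \<omega>) (B n \<omega>))) \<partial>M)"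
    by (rule nn_integral_step_ge[OF A, of "\<lambda>r b k. f r b (r + k) (b + \<sigma> (Suc n) - k)"])
  finally show ?thesis .
qed

end

subsection \<open>Binomial distributions\<close>

lemma nn_integral_binomial_pmf:
  assumes "p \<in> {0..1}"
  shows "(\<integral>\<^sup>+k. f k \<partial>binomial_pmf n p)
    = (\<Sum>k\<le>n. f k * ennreal (real (n choose k) * p ^ k * (1 - p) ^ (n - k)))"
  using assms
  by (subst nn_integral_measure_pmf_support[of "{..n}"]) (auto simp: set_pmf_binomial_eq split: if_splits)

lemma expectation_binomial_pmf_powers:
  fixes x y :: real
  assumes "p \<in> {0..1}"
  shows "measure_pmf.expectation (binomial_pmf n p) (\<lambda>k. x ^ (n - k) * y ^ k) = ((1 - p) * x + p * y) ^ n"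
proof -
  have "((1 - p) * x + p * y) ^ n = (p * y + (1 - p) * x) ^ n" by (simp add: add.commute)
  also have "\<dots> = (\<Sum>k\<le>n. real (n choose k) * (p * y) ^ k * ((1 - p) * x) ^ (n - k))"
    by (rule binomial_ring)
  finally show ?thesis
    by (simp add: expectation_binomial_pmf'[OF assms] power_mult_distrib mult_ac)
qed

lemma nn_integral_binomial_pmf_powers:
  fixes x y :: real
  assumes "p \<in> {0..1}" "x \<ge> 0" "y \<ge> 0"
  shows "(\<integral>\<^sup>+k. ennreal (x ^ (n - k) * y ^ k) \<partial>binomial_pmf n p) = ennreal (((1 - p) * x + p * y) ^ n)"
  using assms
  by (subst nn_integral_eq_integral)
     (auto simp: expectation_binomial_pmf_powers)

lemma nn_integral_binomial_pmf_failures: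
  assumes "p \<in> {0..1}"
  shows "(\<integral>\<^sup>+k. ennreal (real (n - k)) \<partial>binomial_pmf n p) = ennreal (real n * (1 - p))"
proof (cases n)
  case 0
  then show ?thesis by (simp add: nn_integral_binomial_pmf[OF assms])
next
  case (Suc m)
  have "measure_pmf.expectation (binomial_pmf n p) (\<lambda>k. real (n - k))
      = (\<Sum>k\<le>n. real ((n - k) * (n choose k)) * p ^ k * (1 - p) ^ (n - k))"
    by (simp add: expectation_binomial_pmf'[OF assms] mult_ac)
  also have "\<dots> = (\<Sum>k\<le>n. real n * real (m choose k) * p ^ k * (1 - p) ^ (n - k))"
    \<comment> \<open>The absorption identity
      \<open>(n - k) * (n choose k) = n * (n - 1 choose k)\<close> reduces the mean to a binomial
      sum for \<open>m = n - 1\<close>.\<close>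
    using Suc by (intro sum.cong refl) (simp only: binomial_absorb_comp, simp add: algebra_simps)
  also have "\<dots> = (\<Sum>k\<le>m. real n * real (m choose k) * p ^ k * (1 - p) ^ (n - k))"
    using Suc by simp
  also have "\<dots> = (\<Sum>k\<le>m. real n * (1 - p) * (real (m choose k) * p ^ k * (1 - p) ^ (m - k)))"
    using Suc by (intro sum.cong refl) (simp add: Suc_diff_le)
  also have "\<dots> = real n * (1 - p) * (p + (1 - p)) ^ m"
    by (subst binomial_ring) (simp only: sum_distrib_left)
  finally show ?thesis
    using assms by (subst nn_integral_eq_integral) auto
qed

text \<open>
  Paley--Zygmund for the exponential moment \<open>(1 + u) ^ k\<close> with \<open>u = 64 / sqrt m\<close>: the tilt is so
  strong that half of the mean already lies beyond two standard deviations.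
\<close>

lemma binomial_anticoncentration:
  fixes p :: real
  assumes p: "1/2 \<le> p" "p \<le> 1" and m: "m \<ge> 4096"
  shows "measure_pmf.prob (binomial_pmf m p) {k. real m / 2 + sqrt (real m) \<le> real k} \<ge> exp (-1024) / 4"
proof -
  let ?E = "measure_pmf.expectation (binomial_pmf m p)"
  define S where "S = {k. real m / 2 + sqrt (real m) \<le> real k}"
  define u where "u = 64 / sqrt (real m)"
  define K :: real where "K = exp 1024"
  define \<mu> where "\<mu> = (1 + p * u) ^ m"
  have p01: "p \<in> {0..1}" using p by auto
  \<comment> \<open>The bound on \<open>m\<close> serves to make the tilt \<open>u\<close> at most
    1.\<close>
  have "sqrt (real m) \<ge> sqrt 4096" using m by (intro real_sqrt_le_mono) simp
  moreover have "sqrt 4096 = (64::real)" by (rule real_sqrt_unique) auto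
  ultimately have sm: "sqrt (real m) \<ge> 64" by simp
  then have u: "0 < u" "u \<le> 1"
    unfolding u_def by (intro divide_pos_pos, linarith, linarith, subst divide_le_eq_1_pos, linarith, linarith)
  have su: "sqrt (real m) * u = 64" using m by (simp add: u_def)
  have mu2: "real m * u\<^sup>2 = 4096"
    using su by (metis mult.commute power_mult_distrib of_nat_0_le_iff real_sqrt_pow2 power2_eq_square
        numeral_times_numeral num_double semiring_norm(8,13,14) mult_numeral_1)
  have \<mu>: "\<mu> > 0" using u p by (simp add: \<mu>_def add_pos_nonneg)
  have K: "K > 0" by (simp add: K_def)
  have EZ: "?E (\<lambda>k. (1 + u) ^ k) = \<mu>"
    using expectation_binomial_pmf_powers[OF p01, where x=1 and y="1+u" and n=m]
    by (simp add: \<mu>_def algebra_simps)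
  \<comment> \<open>Second moment against squared mean: the ratio per trial is at most
    \<open>1 + u^2 / 4\<close>, because \<open>p * (1 - p) \<le> 1/4\<close>. Over \<open>m\<close>
    trials this gives \<open>exp (m * u^2 / 4)\<close>, which is \<open>K\<close> since
    \<open>m * u^2 = 4096\<close>.\<close>
  have EZ2: "?E (\<lambda>k. ((1 + u) ^ k)\<^sup>2) \<le> K * \<mu>\<^sup>2"
  proof -
    have "?E (\<lambda>k. ((1 + u) ^ k)\<^sup>2) = (1 - p + p * (1 + u)\<^sup>2) ^ m"
      using expectation_binomial_pmf_powers[OF p01, where x=1 and y="(1+u)\<^sup>2" and n=m]
      by (simp add: power_mult[symmetric] mult.commute)
    also have "1 - p + p * (1 + u)\<^sup>2 \<le> (1 + p * u)\<^sup>2 * exp (u\<^sup>2 / 4)"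
    proof -
      have "1 - p + p * (1 + u)\<^sup>2 = (1 + p * u)\<^sup>2 + p * (1 - p) * u\<^sup>2"
        by (simp add: power2_eq_square algebra_simps)
      also have "p * (1 - p) * u\<^sup>2 \<le> 1 / 4 * u\<^sup>2"
      proof (rule mult_right_mono)
        show "p * (1 - p) \<le> 1 / 4"
          using zero_le_power2[of "p - 1/2"] by (simp add: power2_eq_square algebra_simps)
      qed simp
      also have "1 / 4 * u\<^sup>2 \<le> (1 + p * u)\<^sup>2 * (u\<^sup>2 / 4)"
      proof -
        have "1 \<le> (1 + p * u)\<^sup>2" using p u by simp
        from mult_right_mono[OF this, of "u\<^sup>2 / 4"] show ?thesis by simp
      qed
      also have "(1 + p * u)\<^sup>2 + (1 + p * u)\<^sup>2 * (u\<^sup>2 / 4) = (1 + p * u)\<^sup>2 * (1 + u\<^sup>2 / 4)"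
        by (simp add: algebra_simps)
      also have "\<dots> \<le> (1 + p * u)\<^sup>2 * exp (u\<^sup>2 / 4)"
        by (intro mult_left_mono exp_ge_add_one_self) simp
      finally show ?thesis by simp
    qed
    then have "(1 - p + p * (1 + u)\<^sup>2) ^ m \<le> ((1 + p * u)\<^sup>2 * exp (u\<^sup>2 / 4)) ^ m"
      using p by (intro power_mono) auto
    also have "\<dots> = \<mu>\<^sup>2 * exp (real m * (u\<^sup>2 / 4))"
      by (simp only: power_mult_distrib \<mu>_def exp_of_nat_mult power_mult[symmetric] mult.commute[of m 2])
    also have "real m * (u\<^sup>2 / 4) = 1024" using mu2 by simp
    finally show ?thesis by (simp add: K_def mult.commute)
  qed
  \<comment> \<open>Strict concavity of the logarithm is quantified by
    \<open>2 * ln (1 + u / 2) - ln (1 + u) \<ge> u^2 / 16\<close>. Over \<open>m / 2\<close> pairs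
    this gains 128, more than the 64 lost to the term \<open>sqrt m\<close> and the 1 that bounds
    \<open>ln 2\<close>.\<close>
  have small: "(1 + u) ^ k \<le> \<mu> / 2" if "k \<notin> S" for k
  proof -
    have k: "real k \<le> real m / 2 + sqrt (real m)" using that by (simp add: S_def)
    have l1: "ln (1 + u) \<le> u" using u by (intro ln_add_one_self_le_self) simp
    have "u\<^sup>2 \<le> 1" using u by (simp add: power_le_one)
    have "u\<^sup>2 / 16 \<le> u\<^sup>2 / 8 - (u\<^sup>2 / 8)\<^sup>2"
    proof -
      have "y / 16 \<le> y / 8 - (y / 8)\<^sup>2" if "0 \<le> y" "y \<le> 1" for y :: real
        using that mult_left_mono[of y 1 y] by (simp add: power2_eq_square)
      then show ?thesis using \<open>u\<^sup>2 \<le> 1\<close> by simp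
    qed
    also have "\<dots> \<le> ln (1 + u\<^sup>2 / 8)"
      using \<open>u\<^sup>2 \<le> 1\<close> by (intro ln_one_plus_pos_lower_bound) auto
    also have "\<dots> \<le> ln ((1 + u / 2)\<^sup>2 / (1 + u))"
    proof -
      have "(1 + u\<^sup>2 / 8) * (1 + u) \<le> (1 + u / 2)\<^sup>2"
        using u mult_right_mono[of u 1 "u\<^sup>2"] by (simp add: power2_eq_square algebra_simps)
      then have "1 + u\<^sup>2 / 8 \<le> (1 + u / 2)\<^sup>2 / (1 + u)" using u by (simp add: field_simps)
      then show ?thesis by (intro ln_mono) (auto simp: add_pos_nonneg)
    qed
    also have "\<dots> = 2 * ln (1 + u / 2) - ln (1 + u)"
      using u by (simp add: ln_div ln_realpow)
    finally have l2: "u\<^sup>2 / 16 + ln (1 + u) \<le> 2 * ln (1 + u / 2)" by simp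
    have "real k * ln (1 + u) + ln 2 \<le> (real m / 2 + sqrt (real m)) * ln (1 + u) + ln 2"
      using k u by (intro add_right_mono mult_right_mono) auto
    also have "\<dots> \<le> real m / 2 * ln (1 + u) + 64 + 1"
      using mult_left_mono[OF l1, of "sqrt (real m)"] su ln_le_minus_one[of "2::real"] by (simp add: algebra_simps)
    also have "\<dots> \<le> real m / 2 * (u\<^sup>2 / 16 + ln (1 + u))"
      using mu2 by (simp add: algebra_simps)
    also have "\<dots> \<le> real m / 2 * (2 * ln (1 + u / 2))"
      by (intro mult_left_mono l2) simp
    also have "\<dots> = ln ((1 + u / 2) ^ m)" using u by (simp add: ln_realpow)
    finally have "ln ((1 + u) ^ k * 2) \<le> ln ((1 + u / 2) ^ m)"
      using u by (simp add: ln_mult ln_realpow)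
    then have "(1 + u) ^ k * 2 \<le> (1 + u / 2) ^ m" using u by (subst (asm) ln_le_cancel_iff) auto
    also have "\<dots> \<le> \<mu>"
      unfolding \<mu>_def using u p mult_right_mono[of "1/2" p u] by (intro power_mono) auto
    finally show ?thesis by simp
  qed
  \<comment> \<open>In place of Cauchy-Schwarz, completing a square bounds the tilt on
    \<open>S\<close>. Taking expectations, the three terms contribute \<open>\<mu> / 2\<close>, at
    most \<open>\<mu> / 4\<close>, and \<open>K * \<mu>\<close> times the probability of
    \<open>S\<close>.\<close>
  have "(1 + u) ^ k \<le> \<mu> / 2 + (((1 + u) ^ k)\<^sup>2 / (4 * K * \<mu>) + K * \<mu> * indicator S k)" for k
  proof (cases "k \<in> S")
    case False
    have "0 \<le> ((1 + u) ^ k)\<^sup>2 / (4 * K * \<mu>)" using K \<mu> by simp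
    then show ?thesis using small[OF False] False by simp
  next
    case True
    have "0 \<le> ((1 + u) ^ k - 2 * K * \<mu>)\<^sup>2 / (4 * K * \<mu>)" using K \<mu> by simp
    also have "\<dots> = ((1 + u) ^ k)\<^sup>2 / (4 * K * \<mu>) + K * \<mu> - (1 + u) ^ k"
      using K \<mu> by (simp add: field_simps power2_eq_square)
    finally show ?thesis using \<mu> True by simp
  qed
  then have "?E (\<lambda>k. (1 + u) ^ k) \<le> ?E (\<lambda>k. \<mu> / 2 + (((1 + u) ^ k)\<^sup>2 / (4 * K * \<mu>) + K * \<mu> * indicator S k))"
    using p01 by (intro integral_mono) auto
  also have "\<dots> = \<mu> / 2 + (?E (\<lambda>k. ((1 + u) ^ k)\<^sup>2) / (4 * K * \<mu>) + K * \<mu> * ?E (indicator S))"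
    using p01 by simp
  also have "\<dots> \<le> \<mu> / 2 + (K * \<mu>\<^sup>2 / (4 * K * \<mu>) + K * \<mu> * ?E (indicator S))"
    using EZ2 K \<mu> by (intro add_mono divide_right_mono) auto
  also have "K * \<mu>\<^sup>2 / (4 * K * \<mu>) = \<mu> / 4" using K \<mu> by (simp add: field_simps power2_eq_square)
  finally have "\<mu> * (1/4) \<le> \<mu> * (K * ?E (indicator S))" unfolding EZ by (simp add: algebra_simps)
  then have "1/4 \<le> K * measure_pmf.prob (binomial_pmf m p) S" using \<mu> by simp
  then show ?thesis by (simp add: K_def S_def exp_minus field_simps)
qed

section \<open>Monotone interpolation and the total number of balls\<close>

lemma lin_interp_le:
  assumes "mono w" "0 \<le> x" "x \<le> real n"
  shows "lin_interp w x \<le> w n"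
proof (cases "x = real n")
  \<comment> \<open>Strictly below \<open>n\<close> the right end of the cell of \<open>x\<close> is
    still at most \<open>n\<close>; at \<open>x = n\<close> it would be \<open>n + 1\<close>, hence
    the separate case.\<close>
  case False
  define j where "j = nat \<lfloor>x\<rfloor>"
  have j: "real j \<le> x" "x < real j + 1" using assms unfolding j_def by linarith+
  then have "Suc j \<le> n" using False assms by linarith
  then have "w (Suc j) \<le> w n" by (rule monoD[OF assms(1)])
  have "(x - real j) * (w (Suc j) - w j) \<le> 1 * (w (Suc j) - w j)"
    using j monoD[OF assms(1), of j "Suc j"] by (intro mult_right_mono) auto
  then show ?thesis using \<open>w (Suc j) \<le> w n\<close> by (simp add: lin_interp_def j_def)
qed (simp add: lin_interp_def)

lemma lin_interp_ge:
  assumes "mono w" "real n \<le> x"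
  shows "w n \<le> lin_interp w x"
proof -
  define j where "j = nat \<lfloor>x\<rfloor>"
  have j: "real j \<le> x" "n \<le> j" using assms unfolding j_def by linarith+
  have "0 \<le> (x - real j) * (w (Suc j) - w j)"
    using j monoD[OF assms(1), of j "Suc j"] by (intro mult_nonneg_nonneg) auto
  then show ?thesis using monoD[OF assms(1) j(2)] by (simp add: lin_interp_def j_def)
qed

lemma total_balls_commute: "total_balls b r \<sigma> = total_balls r b \<sigma>"
  by (simp add: total_balls_def fun_eq_iff)

lemma total_balls_Suc: "total_balls r b \<sigma> (Suc n) = total_balls r b \<sigma> n + \<sigma> (Suc n)"
  by (simp add: total_balls_def)

section \<open>Totals, exchange of the colours and a zero-one argument\<close>

context gpu_process
begin

abbreviation \<tau> :: "nat \<Rightarrow> nat" where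
  "\<tau> \<equiv> total_balls r0 b0 \<sigma>"

lemma \<tau>_mono: "n \<le> m \<Longrightarrow> \<tau> n \<le> \<tau> m"
  by (rule lift_Suc_mono_le[of \<tau>]) (auto simp: total_balls_Suc)

lemma AE_total: "AE \<omega> in M. \<forall>n. R n \<omega> + B n \<omega> = \<tau> n"
  unfolding AE_all_countable
proof
  fix n
  show "AE \<omega> in M. R n \<omega> + B n \<omega> = \<tau> n"
  proof (induction n)
    case 0
    show ?case using init by eventually_elim (simp add: total_balls_def)
  next
    case (Suc n)
    show ?case using Suc step_total[of n] by eventually_elim (simp add: total_balls_Suc)
  qed
qed

lemma AE_mono: "AE \<omega> in M. mono (\<lambda>n. R n \<omega>)"
  unfolding mono_iff_le_Suc AE_all_countable using AE_R_mono by blast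

text \<open>Only \<open>step_law\<close> treats the colours differently. The law of the blue
  increment follows from the one-step formula applied to its indicator, and every result about red
  then transfers to blue by interpretation.\<close>

lemma swap: "gpu_process M w \<sigma> b0 r0 B R"
proof (unfold_locales)
  show "AE \<omega> in M. B 0 \<omega> = b0 \<and> R 0 \<omega> = r0" using init by (simp add: conj_commute)
  show "AE \<omega> in M. B (Suc n) \<omega> + R (Suc n) \<omega> = B n \<omega> + R n \<omega> + \<sigma> (Suc n)" for n
    using step_total[of n] by eventually_elim linarith
  fix n r b k
  define E where "E = {\<omega>\<in>space M. \<forall>i\<le>n. B i \<omega> = r i \<and> R i \<omega> = b i}"
  define C where "C = {\<omega>\<in>space M. B (Suc n) \<omega> = B n \<omega> + k}"
  define s where "s = \<sigma> (Suc n)"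
  define p where "p = red_prob (b n) (r n)"
  assume "0 < \<P>(\<omega> in M. \<forall>i\<le>n. B i \<omega> = r i \<and> R i \<omega> = b i)"
  then have pos: "prob E > 0" by (simp add: E_def)
  have pE: "past n E" unfolding E_def by (intro past_Collect) auto
  have Cev: "C \<in> events" unfolding C_def
    using events_state[of "\<lambda>_ b _ b'. b' = b + k" n "Suc n"] by simp
  have p: "p \<in> {0..1}" "w (r n) / (w (r n) + w (b n)) = 1 - p" "0 < p" "p < 1"
    using red_prob_bounds[of "b n" "r n"] w_pos[of "r n"] w_pos[of "b n"]
    by (auto simp: p_def red_prob_def field_simps)
  have "emeasure M (E \<inter> C) = (\<integral>\<^sup>+\<omega>\<in>E. of_bool (B (Suc n) \<omega> = B n \<omega> + k) \<partial>M)"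
  proof -
    have "emeasure M (E \<inter> C) = (\<integral>\<^sup>+\<omega>. indicator (E \<inter> C) \<omega> \<partial>M)"
      using past_events[OF pE] Cev by (intro nn_integral_indicator[symmetric]) auto
    also have "\<dots> = (\<integral>\<^sup>+\<omega>\<in>E. of_bool (B (Suc n) \<omega> = B n \<omega> + k) \<partial>M)"
      using sets.sets_into_space[OF past_events[OF pE]]
      by (intro nn_integral_cong) (auto simp: C_def indicator_def)
    finally show ?thesis .
  qed
  also have "\<dots> = (\<integral>\<^sup>+\<omega>\<in>E. (\<integral>\<^sup>+j. of_bool (B n \<omega> + s - j = B n \<omega> + k) 
          \<partial>binomial_pmf s (red_prob (R n \<omega>) (B n \<omega>))) \<partial>M)"
    using nn_integral_step[OF pE, of "\<lambda>_ b _ b'. of_bool (b' = b + k)"] by (simp add: s_def)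
  also have "\<dots> = (\<integral>\<^sup>+\<omega>\<in>E. ennreal (pmf (binomial_pmf s (1 - p)) k) \<partial>M)"
  proof (rule nn_integral_cong)
    fix \<omega>
    \<comment> \<open>Blue gains \<open>k\<close> balls exactly when red gains \<open>s - k\<close>,
      so one term of the sum survives and the symmetry of binomial coefficients identifies it. For
      \<open>k > s\<close> both sides vanish.\<close>
    have "(\<integral>\<^sup>+j. of_bool (r n + s - j = r n + k) \<partial>binomial_pmf s p) = ennreal (pmf (binomial_pmf s (1 - p)) k)"
    proof (cases "k \<le> s")
      case True
      then have "(\<integral>\<^sup>+j. of_bool (r n + s - j = r n + k) \<partial>binomial_pmf s p)
        = (\<Sum>j\<le>s. if j = s - k then ennreal (real (s choose j) * p ^ j * (1 - p) ^ (s - j)) else 0)"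
        by (subst nn_integral_binomial_pmf[OF p(1)]) (intro sum.cong refl, auto)
      also have "\<dots> = ennreal (pmf (binomial_pmf s (1 - p)) k)"
        using True p by (simp add: binomial_symmetric[of k s] mult_ac)
      finally show ?thesis .
    next
      case False
      then have "(\<integral>\<^sup>+j. of_bool (r n + s - j = r n + k) \<partial>binomial_pmf s p) = 0"
        by (subst nn_integral_binomial_pmf[OF p(1)]) (auto intro!: sum.neutral)
      then show ?thesis using False p by (simp add: binomial_eq_0)
    qed
    then show "(\<integral>\<^sup>+j. of_bool (B n \<omega> + s - j = B n \<omega> + k) 
          \<partial>binomial_pmf s (red_prob (R n \<omega>) (B n \<omega>))) * indicator E \<omega>
      = ennreal (pmf (binomial_pmf s (1 - p)) k) * indicator E \<omega>"
      by (auto simp: E_def p_def split: split_indicator)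
  qed
  also have "\<dots> = ennreal (pmf (binomial_pmf s (1 - p)) k) * emeasure M E"
    using past_events[OF pE] by (rule nn_integral_cmult_indicator)
  finally have "prob (E \<inter> C) = pmf (binomial_pmf s (1 - p)) k * prob E"
    by (simp add: emeasure_eq_measure ennreal_mult[symmetric])
  moreover have "E \<inter> C = {\<omega>\<in>space M. B (Suc n) \<omega> = B n \<omega> + k \<and> (\<forall>i\<le>n. B i \<omega> = r i \<and> R i \<omega> = b i)}"
    by (auto simp: E_def C_def)
  ultimately show "\<P>(\<omega> in M. B (Suc n) \<omega> = B n \<omega> + k \<bar> \<forall>i\<le>n. B i \<omega> = r i \<and> R i \<omega> = b i)
      = pmf (binomial_pmf (\<sigma> (Suc n)) (w (r n) / (w (r n) + w (b n)))) k"
    using pos by (simp add: cond_prob_def E_def s_def p(2))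
qed (use w_mono w_pos \<sigma>_pos in auto)

text \<open>
  A null-set criterion in place of Levy's zero-one law: an event that is uniformly avoided given any
  past is null, because it is itself a limit of events of the past.
\<close>

lemma null_if_uniformly_avoided:
  assumes E: "\<And>m k. past (N m k) (E m k)" "\<And>m. incseq (E m)" "\<And>k. decseq (\<lambda>m. E m k)"
    and q: "q < 1"
    and le: "\<And>n A. past n A \<Longrightarrow> prob (A \<inter> (\<Inter>m. \<Union>k. E m k)) \<le> q * prob A"
  shows "prob (\<Inter>m. \<Union>k. E m k) = 0"
proof -
  define F where "F m = (\<Union>k. E m k)" for m
  define G where "G = (\<Inter>m. F m)"
  have Eev[measurable]: "E m k \<in> events" for m k using E(1) past_events by blast
  have Fev[measurable]: "F m \<in> events" for m unfolding F_def by auto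
  have Gev[measurable]: "G \<in> events" unfolding G_def by auto
  have decF: "decseq F" unfolding F_def using E(3) by (force simp: decseq_def)
  \<comment> \<open>The hypothesis is applied to the events \<open>E m k\<close> themselves, which
    increase to \<open>F m\<close>, a superset of \<open>G\<close>.\<close>
  have le1: "prob G \<le> q * prob (F m)" for m
  proof -
    have "(\<lambda>k. prob (E m k \<inter> G)) \<longlonglongrightarrow> prob (\<Union>k. E m k \<inter> G)"
      using E(2)[of m] by (intro finite_Lim_measure_incseq) (auto simp: incseq_def)
    moreover have "(\<Union>k. E m k \<inter> G) = G" by (auto simp: G_def F_def)
    moreover have "(\<lambda>k. q * prob (E m k)) \<longlonglongrightarrow> q * prob (F m)"
      unfolding F_def using E(2)[of m] by (intro tendsto_mult_left finite_Lim_measure_incseq) auto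
    ultimately show ?thesis
      using le[OF E(1)] by (intro LIMSEQ_le[where X="\<lambda>k. prob (E m k \<inter> G)"]) (auto simp: G_def F_def)
  qed
  \<comment> \<open>As \<open>F m\<close> decreases to \<open>G\<close>, the bound becomes
    self-referential and forces probability zero.\<close>
  have "(\<lambda>m. q * prob (F m)) \<longlonglongrightarrow> q * prob G"
    unfolding G_def using decF by (intro tendsto_mult_left finite_Lim_measure_decseq) auto
  then have "prob G \<le> q * prob G"
    using le1 by (intro LIMSEQ_le_const) auto
  then have "(1 - q) * prob G \<le> 0" by (simp add: algebra_simps)
  then have "prob G \<le> 0" using q by (simp add: mult_le_0_iff)
  then show ?thesis using measure_nonneg[of M G] unfolding G_def F_def by simp
qed

end

text \<open>
  The condition on the total holds almost surely; it is included so that both counts can be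
  recovered from their difference pointwise.
\<close>

definition leads :: "(nat \<Rightarrow> nat) \<Rightarrow> (nat \<Rightarrow> real) \<Rightarrow> (nat \<Rightarrow> 'a \<Rightarrow> nat) \<Rightarrow> (nat \<Rightarrow> 'a \<Rightarrow> nat) \<Rightarrow> nat \<Rightarrow> 'a \<Rightarrow> bool" where
  "leads T x X Y n \<omega> \<longleftrightarrow> X n \<omega> + Y n \<omega> = T n \<and> x n \<le> (real (X n \<omega>) - real (Y n \<omega>)) / 2"

section \<open>Two estimates for the exponential potential\<close>

text \<open>With \<open>a = - ln \<kappa>\<close> the logarithm is a downward parabola in
  \<open>sqrt m\<close>, whose maximum is \<open>(ln s)^2 / a\<close>.\<close>

lemma powr_2sqrt_mult_power_bounded:
  fixes s \<kappa> :: real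
  assumes s: "s > 1" and \<kappa>: "0 < \<kappa>" "\<kappa> < 1"
  obtains C where "\<And>m::nat. s powr (2 * sqrt (real m)) * \<kappa> ^ m \<le> C" "C > 0"
proof
  define a where "a = - ln \<kappa>"
  have a: "a > 0" using \<kappa> by (simp add: a_def)
  fix m :: nat
  have "0 \<le> (a * sqrt (real m) - ln s)\<^sup>2 / a" using a by simp
  also have "\<dots> = a * real m - 2 * sqrt (real m) * ln s + (ln s)\<^sup>2 / a"
    using a by (simp add: power2_eq_square field_simps)
  finally have "2 * sqrt (real m) * ln s - a * real m \<le> (ln s)\<^sup>2 / a" by simp
  moreover have "s powr (2 * sqrt (real m)) * \<kappa> ^ m = exp (2 * sqrt (real m) * ln s - a * real m)"
    using s \<kappa> by (simp add: powr_def a_def exp_add exp_of_nat2_mult)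
  ultimately show "s powr (2 * sqrt (real m)) * \<kappa> ^ m \<le> exp ((ln s)\<^sup>2 / a)" by simp
qed simp

text \<open>For \<open>p = t / (1 + t)\<close> the left side is \<open>(1 - p) * x + p / x\<close>,
  the mean factor by which one ball changes a potential that is multiplied by \<open>x\<close> for a
  blue and by \<open>1 / x\<close> for a red ball.\<close>

lemma tilt_identity:
  fixes x t :: real
  assumes "x > 0" "t = x\<^sup>2"
  shows "x - t / (1 + t) * (x - 1 / x) = 2 * x / (1 + x\<^sup>2)"
proof -
  have "1 + x\<^sup>2 > 0" by (simp add: add_pos_nonneg)
  have "x\<^sup>2 * (x - 1 / x) = x * x\<^sup>2 - x"
    using \<open>x > 0\<close> by (simp add: right_diff_distrib power2_eq_square)
  then have "x - t / (1 + t) * (x - 1 / x) = x - (x * x\<^sup>2 - x) / (1 + x\<^sup>2)"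
    by (simp add: assms(2))
  also have "\<dots> = (x * (1 + x\<^sup>2) - (x * x\<^sup>2 - x)) / (1 + x\<^sup>2)"
    using \<open>1 + x\<^sup>2 > 0\<close> by (simp add: diff_divide_distrib)
  finally show ?thesis by (simp add: algebra_simps)
qed

section \<open>Events of the past and the effect of one large step\<close>

context gpu_process
begin

lemma borel_fun_state:
  "(\<lambda>\<omega>. f (R i \<omega>) (B i \<omega>) (R j \<omega>) (B j \<omega>) :: ennreal) \<in> borel_measurable M"
  using measurable_compose[OF measurable_fun_state, of "\<lambda>x. x" borel f i j] by simp

lemma leads_past: "i \<le> n \<Longrightarrow> past n {\<omega>\<in>space M. leads \<tau> x R B i \<omega>}"
  unfolding leads_def
  by (rule past_Collect)
     (use events_state[of "\<lambda>r b _ _. r + b = \<tau> i \<and> x i \<le> (real r - real b) / 2" i i] in auto)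

lemma leads_past_swap: "i \<le> n \<Longrightarrow> past n {\<omega>\<in>space M. leads \<tau> x B R i \<omega>}"
  unfolding leads_def
  by (rule past_Collect)
     (use events_state[of "\<lambda>r b _ _. b + r = \<tau> i \<and> x i \<le> (real b - real r) / 2" i i] in auto)

lemma past_Ball:
  fixes I :: "nat set"
  assumes "\<And>i. i \<in> I \<Longrightarrow> past n {\<omega>\<in>space M. P i \<omega>}"
  shows "past n {\<omega>\<in>space M. \<forall>i\<in>I. P i \<omega>}"
  unfolding past_def
proof (intro conjI)
  have "{\<omega>\<in>space M. i \<in> I \<longrightarrow> P i \<omega>} \<in> events" for i
    using past_events[OF assms, of i] by (cases "i \<in> I") auto
  then have "{\<omega>\<in>space M. \<forall>i. i \<in> I \<longrightarrow> P i \<omega>} \<in> events"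
    by (rule sets.sets_Collect_countable_All)
  then show "{\<omega>\<in>space M. \<forall>i\<in>I. P i \<omega>} \<in> events" by (simp add: Ball_def)
  show "\<forall>\<omega>\<in>{\<omega>\<in>space M. \<forall>i\<in>I. P i \<omega>}. \<forall>\<omega>'\<in>space M.
      (\<forall>i\<le>n. R i \<omega> = R i \<omega>' \<and> B i \<omega> = B i \<omega>') \<longrightarrow> \<omega>' \<in> {\<omega>\<in>space M. \<forall>i\<in>I. P i \<omega>}"
    using assms unfolding past_def by blast
qed

lemma past_Not:
  assumes "past n {\<omega>\<in>space M. P \<omega>}"
  shows "past n {\<omega>\<in>space M. \<not> P \<omega>}"
  unfolding past_def
proof (intro conjI)
  have "space M - {\<omega>\<in>space M. P \<omega>} \<in> events" using past_events[OF assms] by (rule sets.compl_sets)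
  moreover have "space M - {\<omega>\<in>space M. P \<omega>} = {\<omega>\<in>space M. \<not> P \<omega>}" by auto
  ultimately show "{\<omega>\<in>space M. \<not> P \<omega>} \<in> events" by simp
  show "\<forall>\<omega>\<in>{\<omega>\<in>space M. \<not> P \<omega>}. \<forall>\<omega>'\<in>space M.
      (\<forall>i\<le>n. R i \<omega> = R i \<omega>' \<and> B i \<omega> = B i \<omega>') \<longrightarrow> \<omega>' \<in> {\<omega>\<in>space M. \<not> P \<omega>}"
    using assms unfolding past_def by (metis (mono_tags, lifting) mem_Collect_eq)
qed

lemma past_Bex:
  fixes I :: "nat set"
  assumes "\<And>i. i \<in> I \<Longrightarrow> past n {\<omega>\<in>space M. P i \<omega>}"
  shows "past n {\<omega>\<in>space M. \<exists>i\<in>I. P i \<omega>}"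
  using past_Not[OF past_Ball[of I n "\<lambda>i \<omega>. \<not> P i \<omega>"]] past_Not assms by simp

lemma red_prob_ge:
  assumes "\<rho> > 0" "\<rho> * w b \<le> w r"
  shows "\<rho> / (1 + \<rho>) \<le> red_prob r b"
  using assms w_pos[of r] w_pos[of b] by (simp add: red_prob_def field_simps)

text \<open>While red is not behind, each ball is red with probability at least one half, so
  anticoncentration yields \<open>m / 2 + sqrt m\<close> red balls among \<open>m\<close>. This
  raises half the difference of the counts by \<open>sqrt m\<close>.\<close>

lemma spread:
  assumes A: "past n A" and le: "\<And>\<omega>. \<omega> \<in> A \<Longrightarrow> B n \<omega> \<le> R n \<omega>" and \<sigma>: "\<sigma> (Suc n) \<ge> 4096"
  shows "exp (-1024) / 4 * prob A
    \<le> prob (A \<inter> {\<omega>\<in>space M. leads \<tau> (\<lambda>i. sqrt (real (\<sigma> i))) R B (Suc n) \<omega>})" (is "?c * _ \<le> prob (A \<inter> ?L)")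
proof -
  define m where "m = \<sigma> (Suc n)"
  define g :: "nat \<Rightarrow> nat \<Rightarrow> ennreal" where "g r b = of_bool (sqrt (real m) \<le> (real r - real b) / 2)" for r b
  have Aev: "A \<in> events" "A \<subseteq> space M" using past_events[OF A] sets.sets_into_space by auto
  have Lev: "?L \<in> events" using leads_past[of "Suc n" "Suc n"] past_events by blast
  have "ennreal ?c * emeasure M A = (\<integral>\<^sup>+\<omega>\<in>A. ennreal ?c \<partial>M)"
    using Aev by (simp add: nn_integral_cmult_indicator)
  also have "\<dots> \<le> (\<integral>\<^sup>+\<omega>\<in>A. (\<integral>\<^sup>+k. g (R n \<omega> + k) (B n \<omega> + \<sigma> (Suc n) - k)
      \<partial>binomial_pmf (\<sigma> (Suc n)) (red_prob (R n \<omega>) (B n \<omega>))) \<partial>M)"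
  proof (rule nn_integral_mono)
    fix \<omega>
    define r b p where "r = R n \<omega>" and "b = B n \<omega>" and "p = red_prob r b"
    have "ennreal ?c \<le> (\<integral>\<^sup>+k. g (r + k) (b + m - k) \<partial>binomial_pmf m p)" if "\<omega> \<in> A"
    proof -
      have br: "b \<le> r" using le[OF that] by (simp add: r_def b_def)
      have p: "1/2 \<le> p" "p < 1" "0 < p"
        using red_prob_ge[of 1 b r] monoD[OF w_mono br] red_prob_bounds by (auto simp: p_def)
      have "ennreal ?c \<le> emeasure (binomial_pmf m p) {k. real m / 2 + sqrt (real m) \<le> real k}"
        using binomial_anticoncentration[of p m] p \<sigma>
        by (subst measure_pmf.emeasure_eq_measure) (auto simp: m_def intro!: ennreal_leI)
      also have "\<dots> = (\<integral>\<^sup>+k. indicator {k. real m / 2 + sqrt (real m) \<le> real k} k \<partial>binomial_pmf m p)"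
        by simp
      also have "\<dots> \<le> (\<integral>\<^sup>+k. g (r + k) (b + m - k) \<partial>binomial_pmf m p)"
      proof (rule nn_integral_mono_AE)
        show "AE k in binomial_pmf m p. indicator {k. real m / 2 + sqrt (real m) \<le> real k} k \<le> g (r + k) (b + m - k)"
          unfolding AE_measure_pmf_iff using p br
          by (auto simp: g_def indicator_def of_nat_diff field_simps)
      qed
      finally show ?thesis .
    qed
    then show "ennreal ?c * indicator A \<omega> \<le> (\<integral>\<^sup>+k. g (R n \<omega> + k) (B n \<omega> + \<sigma> (Suc n) - k)
      \<partial>binomial_pmf (\<sigma> (Suc n)) (red_prob (R n \<omega>) (B n \<omega>))) * indicator A \<omega>"
      by (auto simp: r_def b_def p_def m_def split: split_indicator)
  qed
  also have "\<dots> = (\<integral>\<^sup>+\<omega>\<in>A. g (R (Suc n) \<omega>) (B (Suc n) \<omega>) \<partial>M)"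
    by (rule nn_integral_step[OF A, symmetric, where f="\<lambda>_ _. g"])
  also have "\<dots> \<le> (\<integral>\<^sup>+\<omega>. indicator (A \<inter> ?L) \<omega> \<partial>M)"
  proof (rule nn_integral_mono_AE)
    show "AE \<omega> in M. g (R (Suc n) \<omega>) (B (Suc n) \<omega>) * indicator A \<omega> \<le> indicator (A \<inter> ?L) \<omega>"
      using AE_total AE_space by eventually_elim (auto simp: g_def leads_def indicator_def m_def)
  qed
  also have "\<dots> = emeasure M (A \<inter> ?L)" using Aev Lev by (intro nn_integral_indicator) auto
  finally show ?thesis
    by (simp add: emeasure_eq_measure ennreal_mult[symmetric])
qed

end

subsection \<open>Persistence of the lead\<close>

text \<open>Assumption (ii) with its witnesses fixed. As \<open>\<rho>\<close> and \<open>n1\<close>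
  are parameters, the interpretations for red and for blue share all constants derived from
  \<open>\<rho>\<close>.\<close>

locale gpu_bias = gpu_process +
  fixes \<rho> :: real and n1 :: nat
  assumes \<rho>: "\<rho> > 1"
    and bias: "\<And>n. n \<ge> n1 \<Longrightarrow> \<rho> * lin_interp w (real (total_balls r0 b0 \<sigma> n) / 2)
        \<le> lin_interp w (real (total_balls r0 b0 \<sigma> n) / 2 + sqrt (real (\<sigma> n)))"
begin

abbreviation ahead :: "nat \<Rightarrow> 'a \<Rightarrow> bool" where
  "ahead \<equiv> leads \<tau> (\<lambda>i. sqrt (real (\<sigma> i))) R B"

text \<open>
  The tilt \<open>s\<close> minimises \<open>(1 - p) * s + p / s\<close> for \<open>p = \<rho> / (1 + \<rho>)\<close>, the smallest probability of a
  red ball while red is ahead; \<open>q\<close> is the minimum.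
\<close>

definition s :: real where "s = sqrt \<rho>"

definition q :: real where "q = 2 * s / (1 + s\<^sup>2)"

text \<open>The square root splits \<open>q\<close> into two equal factors: a power of one pays for
  a threshold of size \<open>sqrt (\<sigma> k)\<close> or \<open>\<epsilon> * \<tau> k\<close>, the
  same power of the other remains as a summable geometric rate.\<close>

definition \<kappa> :: real where "\<kappa> = sqrt q"

definition stay :: "nat \<Rightarrow> nat \<Rightarrow> 'a set" where
  "stay n k = {\<omega>\<in>space M. \<forall>i\<in>{n..k}. ahead i \<omega>}"

lemma s_gt_1: "s > 1" using \<rho> by (simp add: s_def)

lemma q_bounds: "0 < q" "q < 1"
proof -
  show "0 < q" using s_gt_1 by (simp add: q_def add_pos_nonneg)
  have "0 < (s - 1)\<^sup>2" using s_gt_1 by simp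
  then have "2 * s < 1 + s\<^sup>2" by (simp add: power2_eq_square algebra_simps)
  then show "q < 1" by (simp add: q_def divide_less_eq add_pos_nonneg)
qed

lemma \<kappa>_bounds: "0 < \<kappa>" "\<kappa> < 1" and q_eq: "q = \<kappa> * \<kappa>"
  using q_bounds by (auto simp: \<kappa>_def)

lemma stay_past: "past k (stay n k)"
  unfolding stay_def by (intro past_Ball leads_past) simp

text \<open>A lead of \<open>sqrt (\<sigma> n)\<close> puts blue at or below
  \<open>\<tau> n / 2\<close> and red at or above \<open>\<tau> n / 2 + sqrt (\<sigma> n)\<close>,
  the two points compared in \<open>bias\<close>.\<close>

lemma ahead_weights:
  assumes "ahead n \<omega>" "n1 \<le> n"
  shows "\<rho> * w (B n \<omega>) \<le> w (R n \<omega>)"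
proof -
  have t: "real (R n \<omega>) + real (B n \<omega>) = real (\<tau> n)"
    and d: "sqrt (real (\<sigma> n)) \<le> (real (R n \<omega>) - real (B n \<omega>)) / 2"
    using assms(1) by (auto simp: leads_def of_nat_add[symmetric] simp del: of_nat_add)
  have gen: "b \<le> t / 2 \<and> t / 2 + x \<le> r" if "0 \<le> x" "r + b = t" "x \<le> (r - b) / 2" for r b t x :: real
    using that by (simp add: field_simps)
  have "real (B n \<omega>) \<le> real (\<tau> n) / 2 \<and> real (\<tau> n) / 2 + sqrt (real (\<sigma> n)) \<le> real (R n \<omega>)"
    using gen[OF _ t d] by simp
  then have "\<rho> * w (B n \<omega>) \<le> \<rho> * lin_interp w (real (\<tau> n) / 2)"
    and "lin_interp w (real (\<tau> n) / 2 + sqrt (real (\<sigma> n))) \<le> w (R n \<omega>)"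
    using \<rho> w_mono by (auto intro!: mult_left_mono lin_interp_ge lin_interp_le)
  with bias[OF assms(2)] show ?thesis by linarith
qed

text \<open>Given the past, the balls of a step independently multiply \<open>s ^ B / s ^ R\<close>
  by \<open>s\<close> or \<open>1 / s\<close>. The conditional mean factor is thus
  \<open>((1 - p) * s + p / s) ^ \<sigma> (Suc n)\<close>.\<close>

lemma potential_step:
  assumes A: "past n A" and ahead: "\<And>\<omega>. \<omega> \<in> A \<Longrightarrow> ahead n \<omega>" and n: "n1 \<le> n"
  shows "(\<integral>\<^sup>+\<omega>\<in>A. ennreal (s ^ B (Suc n) \<omega> / s ^ R (Suc n) \<omega>) \<partial>M)
    \<le> ennreal (q ^ \<sigma> (Suc n)) * (\<integral>\<^sup>+\<omega>\<in>A. ennreal (s ^ B n \<omega> / s ^ R n \<omega>) \<partial>M)"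
proof -
  have "(\<integral>\<^sup>+\<omega>\<in>A. ennreal (s ^ B (Suc n) \<omega> / s ^ R (Suc n) \<omega>) \<partial>M)
    = (\<integral>\<^sup>+\<omega>\<in>A. (\<integral>\<^sup>+k. ennreal (s ^ (B n \<omega> + \<sigma> (Suc n) - k) / s ^ (R n \<omega> + k))
      \<partial>binomial_pmf (\<sigma> (Suc n)) (red_prob (R n \<omega>) (B n \<omega>))) \<partial>M)"
    by (rule nn_integral_step[OF A, where f="\<lambda>_ _ r b. ennreal (s ^ b / s ^ r)"])
  also have "\<dots> \<le> (\<integral>\<^sup>+\<omega>. ennreal (q ^ \<sigma> (Suc n)) * (ennreal (s ^ B n \<omega> / s ^ R n \<omega>) * indicator A \<omega>) \<partial>M)"
  proof (rule nn_integral_mono)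
    fix \<omega>
    define r b p m where "r = R n \<omega>" and "b = B n \<omega>" and "p = red_prob r b" and "m = \<sigma> (Suc n)"
    have "(\<integral>\<^sup>+k. ennreal (s ^ (b + m - k) / s ^ (r + k)) \<partial>binomial_pmf m p)
        \<le> ennreal (q ^ m) * ennreal (s ^ b / s ^ r)" if "\<omega> \<in> A"
    proof -
      have p: "0 < p" "p < 1" "\<rho> / (1 + \<rho>) \<le> p"
        using red_prob_bounds red_prob_ge[OF _ ahead_weights[OF ahead[OF that] n]] \<rho>
        by (auto simp: p_def r_def b_def)
      have "(1 - p) * s + p * (1 / s) = s - p * (s - 1 / s)" by (simp add: algebra_simps)
      \<comment> \<open>Since \<open>s > 1 / s\<close>, the factor decreases in \<open>p\<close>,
        and the smallest possible \<open>p\<close> is the worst case.\<close>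
      also have "\<dots> \<le> s - \<rho> / (1 + \<rho>) * (s - 1 / s)"
        using p less_1_mult[OF s_gt_1 s_gt_1] s_gt_1 by (intro diff_left_mono mult_right_mono) (auto simp: field_simps)
      also have "\<dots> = q"
        using tilt_identity[of s \<rho>] \<rho> s_gt_1 by (simp add: q_def s_def)
      finally have le: "(1 - p) * s + p * (1 / s) \<le> q" .
      have "(\<integral>\<^sup>+k. ennreal (s ^ (b + m - k) / s ^ (r + k)) \<partial>binomial_pmf m p)
        = (\<integral>\<^sup>+k. ennreal (s ^ b / s ^ r) * ennreal (s ^ (m - k) * (1 / s) ^ k) \<partial>binomial_pmf m p)"
      proof (rule nn_integral_cong_AE)
        show "AE k in binomial_pmf m p. ennreal (s ^ (b + m - k) / s ^ (r + k))
            = ennreal (s ^ b / s ^ r) * ennreal (s ^ (m - k) * (1 / s) ^ k)"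
          unfolding AE_measure_pmf_iff
        proof
          fix k assume "k \<in> set_pmf (binomial_pmf m p)"
          then have "k \<le> m" using p by simp
          then have eq: "s ^ (b + m - k) / s ^ (r + k) = s ^ b / s ^ r * (s ^ (m - k) * (1 / s) ^ k)"
            by (simp add: power_add[symmetric] power_one_over Nat.add_diff_assoc)
          show "ennreal (s ^ (b + m - k) / s ^ (r + k))
            = ennreal (s ^ b / s ^ r) * ennreal (s ^ (m - k) * (1 / s) ^ k)"
            unfolding eq using s_gt_1 by (intro ennreal_mult) auto
        qed
      qed
      also have "\<dots> = ennreal (s ^ b / s ^ r) * ennreal (((1 - p) * s + p * (1 / s)) ^ m)"
        using p s_gt_1 by (simp add: nn_integral_cmult nn_integral_binomial_pmf_powers)
      also have "\<dots> \<le> ennreal (s ^ b / s ^ r) * ennreal (q ^ m)"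
        using le p s_gt_1 by (intro mult_left_mono ennreal_leI power_mono) auto
      finally show ?thesis by (simp add: mult.commute)
    qed
    then show "(\<integral>\<^sup>+k. ennreal (s ^ (B n \<omega> + \<sigma> (Suc n) - k) / s ^ (R n \<omega> + k))
      \<partial>binomial_pmf (\<sigma> (Suc n)) (red_prob (R n \<omega>) (B n \<omega>))) * indicator A \<omega>
      \<le> ennreal (q ^ \<sigma> (Suc n)) * (ennreal (s ^ B n \<omega> / s ^ R n \<omega>) * indicator A \<omega>)"
      by (auto simp: r_def b_def p_def m_def split: split_indicator)
  qed
  also have "\<dots> = ennreal (q ^ \<sigma> (Suc n)) * (\<integral>\<^sup>+\<omega>\<in>A. ennreal (s ^ B n \<omega> / s ^ R n \<omega>) \<partial>M)"
    using past_events[OF A] borel_fun_state[of "\<lambda>r b _ _. ennreal (s ^ b / s ^ r)" n n]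
    by (intro nn_integral_cmult borel_measurable_times_ennreal borel_measurable_indicator) auto
  finally show ?thesis .
qed

end

section \<open>Exponential decay of the potential while the lead lasts\<close>

context gpu_bias
begin

lemma potential_powr: "s ^ b / s ^ r = s powr (- 2 * ((real r - real b) / 2))"
proof -
  have "- 2 * ((real r - real b) / 2) = real b - real r" by simp
  then show ?thesis using s_gt_1 by (simp only: powr_diff) (simp add: powr_realpow)
qed

text \<open>\<open>potential_step\<close> is iterated, and the exponents of \<open>q\<close> add up
  to the number of balls drawn since step \<open>n\<close>. Each step needs the lead at its start;
  forgetting the most recent lead condition then restores the induction hypothesis. The initial lead
  supplies the factor \<open>s powr (- 2 * sqrt (\<sigma> n))\<close>.\<close>

lemma potential_decay:
  assumes A: "past n A" and n: "n1 \<le> n"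
  shows "(\<integral>\<^sup>+\<omega>\<in>A \<inter> stay n (n + j). ennreal (s ^ B (Suc (n + j)) \<omega> / s ^ R (Suc (n + j)) \<omega>) \<partial>M)
    \<le> ennreal (q ^ (\<tau> (Suc (n + j)) - \<tau> n) * s powr (- 2 * sqrt (real (\<sigma> n)))) * emeasure M A"
proof (induction j)
  case 0
  have "past n (A \<inter> stay n n)" using past_Int[OF A stay_past] .
  then have "(\<integral>\<^sup>+\<omega>\<in>A \<inter> stay n n. ennreal (s ^ B (Suc n) \<omega> / s ^ R (Suc n) \<omega>) \<partial>M)
    \<le> ennreal (q ^ \<sigma> (Suc n)) * (\<integral>\<^sup>+\<omega>\<in>A \<inter> stay n n. ennreal (s ^ B n \<omega> / s ^ R n \<omega>) \<partial>M)"
    by (rule potential_step[OF _ _ n]) (simp add: stay_def)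
  also have "(\<integral>\<^sup>+\<omega>\<in>A \<inter> stay n n. ennreal (s ^ B n \<omega> / s ^ R n \<omega>) \<partial>M)
    \<le> (\<integral>\<^sup>+\<omega>\<in>A. ennreal (s powr (- 2 * sqrt (real (\<sigma> n)))) \<partial>M)"
    unfolding potential_powr using s_gt_1
    by (intro nn_integral_mono)
       (auto simp: stay_def leads_def indicator_def intro!: ennreal_leI powr_mono)
  also have "\<dots> = ennreal (s powr (- 2 * sqrt (real (\<sigma> n)))) * emeasure M A"
    using past_events[OF A] by (rule nn_integral_cmult_indicator)
  finally show ?case
    using q_bounds by (simp add: total_balls_Suc ennreal_mult mult.assoc mult_left_mono)
next
  case (Suc j)
  let ?k = "Suc (n + j)"
  have "past ?k (A \<inter> stay n ?k)" using past_Int[OF past_mono[OF A] stay_past] by simp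
  then have "(\<integral>\<^sup>+\<omega>\<in>A \<inter> stay n ?k. ennreal (s ^ B (Suc ?k) \<omega> / s ^ R (Suc ?k) \<omega>) \<partial>M)
    \<le> ennreal (q ^ \<sigma> (Suc ?k)) * (\<integral>\<^sup>+\<omega>\<in>A \<inter> stay n ?k. ennreal (s ^ B ?k \<omega> / s ^ R ?k \<omega>) \<partial>M)"
    using n by (intro potential_step) (auto simp: stay_def)
  also have "(\<integral>\<^sup>+\<omega>\<in>A \<inter> stay n ?k. ennreal (s ^ B ?k \<omega> / s ^ R ?k \<omega>) \<partial>M)
    \<le> (\<integral>\<^sup>+\<omega>\<in>A \<inter> stay n (n + j). ennreal (s ^ B ?k \<omega> / s ^ R ?k \<omega>) \<partial>M)"
    by (intro nn_integral_mono) (auto simp: stay_def indicator_def)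
  also have "\<dots> \<le> ennreal (q ^ (\<tau> ?k - \<tau> n) * s powr (- 2 * sqrt (real (\<sigma> n)))) * emeasure M A"
    by (rule Suc)
  also have "ennreal (q ^ \<sigma> (Suc ?k)) * \<dots>
    = ennreal (q ^ \<sigma> (Suc ?k) * (q ^ (\<tau> ?k - \<tau> n) * s powr (- 2 * sqrt (real (\<sigma> n))))) * emeasure M A"
    using q_bounds by (subst ennreal_mult[of "q ^ \<sigma> (Suc ?k)"]) (auto simp: mult.assoc)
  also have "q ^ \<sigma> (Suc ?k) * (q ^ (\<tau> ?k - \<tau> n) * s powr (- 2 * sqrt (real (\<sigma> n))))
    = q ^ (\<tau> (Suc ?k) - \<tau> n) * s powr (- 2 * sqrt (real (\<sigma> n)))"
  proof -
    have "\<tau> n \<le> \<tau> ?k" using \<tau>_mono[of n ?k] by simp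
    then have "\<tau> (Suc ?k) - \<tau> n = \<sigma> (Suc ?k) + (\<tau> ?k - \<tau> n)" by (simp add: total_balls_Suc[of _ _ _ ?k])
    then show ?thesis by (simp add: power_add)
  qed
  finally show ?case by (simp add: mult_left_mono)
qed

text \<open>Markov's inequality for the potential, which is at least \<open>s powr (- 2 * x)\<close>
  on the event. It serves with \<open>x = sqrt (\<sigma> k)\<close> to bound the loss of the lead
  and with \<open>x = \<epsilon> * \<tau> k\<close> to obtain linear growth.\<close>

lemma lead_prob:
  assumes A: "past n A" and n: "n1 \<le> n"
  shows "prob (A \<inter> stay n (n + j) \<inter>
      {\<omega>\<in>space M. (real (R (Suc (n + j)) \<omega>) - real (B (Suc (n + j)) \<omega>)) / 2 \<le> x})
    \<le> s powr (2 * x) * q ^ (\<tau> (Suc (n + j)) - \<tau> n) * s powr (- 2 * sqrt (real (\<sigma> n))) * prob A"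
    (is "prob (_ \<inter> ?F) \<le> _")
proof -
  let ?k = "Suc (n + j)"
  let ?c = "q ^ (\<tau> ?k - \<tau> n) * s powr (- 2 * sqrt (real (\<sigma> n)))"
  define E where "E = A \<inter> stay n (n + j) \<inter> ?F"
  have "?F \<in> events"
    using events_state[of "\<lambda>r b _ _. (real r - real b) / 2 \<le> x" ?k ?k] .
  then have Eev: "E \<in> events"
    unfolding E_def by (intro sets.Int past_events[OF A] past_events[OF stay_past])
  have "ennreal (s powr (- 2 * x)) * emeasure M E = (\<integral>\<^sup>+\<omega>\<in>E. ennreal (s powr (- 2 * x)) \<partial>M)"
    using Eev by (rule nn_integral_cmult_indicator[symmetric])
  also have "\<dots> \<le> (\<integral>\<^sup>+\<omega>\<in>A \<inter> stay n (n + j). ennreal (s ^ B ?k \<omega> / s ^ R ?k \<omega>) \<partial>M)"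
    unfolding potential_powr using s_gt_1
    by (intro nn_integral_mono) (auto simp: E_def indicator_def intro!: ennreal_leI powr_mono)
  also have "\<dots> \<le> ennreal ?c * emeasure M A"
    by (rule potential_decay[OF A n])
  finally have "s powr (- 2 * x) * prob E \<le> ?c * prob A"
    using q_bounds by (simp add: emeasure_eq_measure ennreal_mult[symmetric])
  then have "s powr (2 * x) * (s powr (- 2 * x) * prob E) \<le> s powr (2 * x) * (?c * prob A)"
    by (intro mult_left_mono) auto
  also have "s powr (2 * x) * (s powr (- 2 * x) * prob E) = prob E"
    using s_gt_1 by (simp add: mult.assoc[symmetric] powr_add[symmetric])
  finally show ?thesis by (simp only: E_def mult.assoc)
qed

lemma \<tau>_diff_ge: "Suc j \<le> \<tau> (Suc (n + j)) - \<tau> n"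
proof (induction j)
  case 0
  show ?case using \<sigma>_pos[of "Suc n"] by (simp add: total_balls_Suc)
next
  case (Suc j)
  then show ?case using \<sigma>_pos[of "Suc (Suc (n + j))"] by (simp add: total_balls_Suc)
qed

section \<open>Keeping the lead forever and linear dominance\<close>

definition forever :: "nat \<Rightarrow> 'a set" where
  "forever n = {\<omega>\<in>space M. \<forall>i\<ge>n. ahead i \<omega>}"

lemma forever_eq: "forever n = (\<Inter>j. stay n (n + j))"
proof (intro equalityI subsetI)
  fix \<omega> assume *: "\<omega> \<in> (\<Inter>j. stay n (n + j))"
  have "ahead i \<omega>" if "n \<le> i" for i
  proof -
    have "\<omega> \<in> stay n (n + (i - n))" using * by blast
    then show ?thesis using that by (simp add: stay_def)
  qed
  moreover have "\<omega> \<in> space M" using * by (auto simp: stay_def)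
  ultimately show "\<omega> \<in> forever n" by (simp add: forever_def)
qed (auto simp: forever_def stay_def)

text \<open>A union bound over the first time the lead is lost: the probabilities are geometric in
  the elapsed time, with a prefactor that is small when the initial lead
  \<open>sqrt (\<sigma> n)\<close> is large.\<close>

lemma stay_forever:
  obtains L where "\<And>n A. n1 \<le> n \<Longrightarrow> L \<le> \<sigma> n \<Longrightarrow> past n A \<Longrightarrow> (\<And>\<omega>. \<omega> \<in> A \<Longrightarrow> ahead n \<omega>) \<Longrightarrow>
    prob A / 2 \<le> prob (A \<inter> forever n)"
proof -
  obtain C where C: "\<And>m::nat. s powr (2 * sqrt (real m)) * \<kappa> ^ m \<le> C" "C > 0"
    using powr_2sqrt_mult_power_bounded[OF s_gt_1 \<kappa>_bounds] by blast
  \<comment> \<open>Chosen so that the total loss, at most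
    \<open>C * \<theta> / (1 - \<kappa>)\<close> relative to \<open>prob A\<close>, equals one
    half.\<close>
  define \<theta> where "\<theta> = (1 - \<kappa>) / (2 * C)"
  have \<theta>: "\<theta> > 0" using C \<kappa>_bounds by (simp add: \<theta>_def)
  \<comment> \<open>A lead of at least \<open>y\<close> makes the prefactor at most
    \<open>\<theta>\<close>; the absolute value covers either sign of
    \<open>ln \<theta>\<close>.\<close>
  define y where "y = \<bar>ln \<theta> / (2 * ln s)\<bar>"
  define L where "L = nat \<lceil>y\<^sup>2\<rceil>"
  have "prob A / 2 \<le> prob (A \<inter> forever n)"
    if n: "n1 \<le> n" and L: "L \<le> \<sigma> n" and A: "past n A" and ahead: "\<And>\<omega>. \<omega> \<in> A \<Longrightarrow> ahead n \<omega>" for n A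
  proof -
    have small: "s powr (- 2 * sqrt (real (\<sigma> n))) \<le> \<theta>"
    proof -
      have "y\<^sup>2 \<le> real L" unfolding L_def by (rule real_nat_ceiling_ge)
      also have "real L \<le> real (\<sigma> n)" using L by simp
      finally have "y \<le> sqrt (real (\<sigma> n))" by (intro real_le_rsqrt)
      then have "- (ln \<theta> / (2 * ln s)) \<le> sqrt (real (\<sigma> n))" unfolding y_def by linarith
      then have "- ln \<theta> \<le> 2 * ln s * sqrt (real (\<sigma> n))"
        using s_gt_1 by (simp add: field_simps)
      then have "- 2 * sqrt (real (\<sigma> n)) * ln s \<le> ln \<theta>" by (simp add: algebra_simps)
      then have "exp (- 2 * sqrt (real (\<sigma> n)) * ln s) \<le> exp (ln \<theta>)" by simp
      then show ?thesis using s_gt_1 \<theta> by (simp add: powr_def)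
    qed
    have Aev: "A \<in> events" "A \<subseteq> space M" using past_events[OF A] sets.sets_into_space by auto
    have Sev: "stay n k \<in> events" for k using past_events[OF stay_past] .
    have step: "prob (A \<inter> stay n (n + j)) \<le> prob (A \<inter> stay n (n + Suc j)) + C * \<theta> * prob A * \<kappa> ^ j" for j
    proof -
      let ?k = "Suc (n + j)"
      let ?d = "\<tau> ?k - \<tau> n"
      define F where "F = {\<omega>\<in>space M. (real (R ?k \<omega>) - real (B ?k \<omega>)) / 2 \<le> sqrt (real (\<sigma> ?k))}"
      have Fev: "F \<in> events" unfolding F_def
        using events_state[of "\<lambda>r b _ _. (real r - real b) / 2 \<le> sqrt (real (\<sigma> ?k))" ?k ?k] .
      have "prob (A \<inter> stay n (n + j)) \<le> prob ((A \<inter> stay n ?k) \<union> (A \<inter> stay n (n + j) \<inter> F))"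
      proof (rule finite_measure_mono_AE)
        show "AE \<omega> in M. \<omega> \<in> A \<inter> stay n (n + j) \<longrightarrow> \<omega> \<in> (A \<inter> stay n ?k) \<union> (A \<inter> stay n (n + j) \<inter> F)"
          using AE_total AE_space
        proof eventually_elim
          case (elim \<omega>)
          then have "\<omega> \<in> F \<or> ahead ?k \<omega>" by (auto simp: F_def leads_def)
          then show ?case by (auto simp: stay_def le_Suc_eq)
        qed
      qed (intro sets.Un sets.Int Aev Sev Fev)
      also have "\<dots> \<le> prob (A \<inter> stay n ?k) + prob (A \<inter> stay n (n + j) \<inter> F)"
        by (intro measure_Un_le sets.Int Aev Sev Fev)
      also have "prob (A \<inter> stay n (n + j) \<inter> F)
          \<le> s powr (2 * sqrt (real (\<sigma> ?k))) * q ^ ?d * s powr (- 2 * sqrt (real (\<sigma> n))) * prob A"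
        unfolding F_def by (rule lead_prob[OF A n])
      also have "\<dots> \<le> (C * \<kappa> ^ j) * \<theta> * prob A"
      proof (rule mult_right_mono[OF mult_mono[OF _ small]])
        \<comment> \<open>The exponent \<open>?d\<close> dominates both \<open>\<sigma> ?k\<close>
          and \<open>j\<close>: one factor \<open>\<kappa> ^ ?d\<close> absorbs the square-root
          threshold into \<open>C\<close>, the other decays like
          \<open>\<kappa> ^ j\<close>.\<close>
        have "\<sigma> ?k \<le> ?d" using \<tau>_mono[of n "n + j"] by (simp add: total_balls_Suc)
        have "s powr (2 * sqrt (real (\<sigma> ?k))) * q ^ ?d = s powr (2 * sqrt (real (\<sigma> ?k))) * \<kappa> ^ ?d * \<kappa> ^ ?d"
          by (simp add: q_eq power_mult_distrib)
        also have "\<dots> \<le> s powr (2 * sqrt (real (\<sigma> ?k))) * \<kappa> ^ \<sigma> ?k * \<kappa> ^ j"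
          using \<kappa>_bounds \<open>\<sigma> ?k \<le> ?d\<close> \<tau>_diff_ge[of j n]
          by (intro mult_mono mult_left_mono power_decreasing) auto
        also have "\<dots> \<le> C * \<kappa> ^ j"
          using \<kappa>_bounds by (intro mult_right_mono C) auto
        finally show "s powr (2 * sqrt (real (\<sigma> ?k))) * q ^ ?d \<le> C * \<kappa> ^ j" .
      qed (use C \<kappa>_bounds in auto)
      finally show ?thesis by (simp add: mult_ac)
    qed
    have bound: "prob A - C * \<theta> * prob A * (\<Sum>i<j. \<kappa> ^ i) \<le> prob (A \<inter> stay n (n + j))" for j
    proof (induction j)
      case 0
      have "A \<inter> stay n n = A" using Aev ahead by (auto simp: stay_def)
      then show ?case by simp
    next
      case (Suc j)
      then show ?case using step[of j] by (simp add: algebra_simps)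
    qed
    have half: "prob A / 2 \<le> prob (A \<inter> stay n (n + j))" for j
    proof -
      have "(\<Sum>i<j. \<kappa> ^ i) = (1 - \<kappa> ^ j) / (1 - \<kappa>)"
        using \<kappa>_bounds by (simp add: sum_gp_strict)
      also have "\<dots> \<le> 1 / (1 - \<kappa>)" using \<kappa>_bounds by (intro divide_right_mono) auto
      finally have "C * \<theta> * prob A * (\<Sum>i<j. \<kappa> ^ i) \<le> C * \<theta> * prob A * (1 / (1 - \<kappa>))"
        using C \<theta> by (intro mult_left_mono) auto
      also have "\<dots> = prob A / 2"
      proof -
        have cancel: "x / 2 * a * (1 / x) = a / 2" if "x \<noteq> 0" for x a :: real using that by simp
        have "C * \<theta> = (1 - \<kappa>) / 2" using C by (simp add: \<theta>_def)
        then show ?thesis using \<kappa>_bounds by (simp only:) (intro cancel, simp)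
      qed
      finally show ?thesis using bound[of j] by linarith
    qed
    have "(\<lambda>j. prob (A \<inter> stay n (n + j))) \<longlonglongrightarrow> prob (\<Inter>j. A \<inter> stay n (n + j))"
      by (intro finite_Lim_measure_decseq) (auto simp: decseq_def stay_def intro!: sets.Int Aev Sev[unfolded stay_def])
    moreover have "(\<Inter>j. A \<inter> stay n (n + j)) = A \<inter> forever n" by (auto simp: forever_eq)
    ultimately show ?thesis using half by (intro LIMSEQ_le_const) auto
  qed
  then show ?thesis by (rule that)
qed

text \<open>The second bound is the largest slope with
  \<open>s powr (2 * \<epsilon>) * \<kappa> \<le> 1\<close>; the cap \<open>1/4\<close> keeps
  \<open>\<epsilon>\<close> in the range of (iii).\<close>

definition \<epsilon> :: real where "\<epsilon> = min (1/4) (- ln \<kappa> / (2 * ln s))"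

lemma \<epsilon>_bounds: "0 < \<epsilon>" "\<epsilon> < 1/2"
proof -
  have "- ln \<kappa> / (2 * ln s) > 0" using s_gt_1 \<kappa>_bounds by (intro divide_pos_pos) auto
  then show "0 < \<epsilon>" "\<epsilon> < 1/2" by (auto simp: \<epsilon>_def)
qed

lemma powr_\<epsilon>: "s powr (2 * (\<epsilon> * real m)) * \<kappa> ^ m \<le> 1"
proof -
  have "2 * \<epsilon> * ln s \<le> - ln \<kappa>"
    using s_gt_1 by (simp add: \<epsilon>_def min_def field_simps)
  then have "real m * (2 * \<epsilon> * ln s + ln \<kappa>) \<le> 0" by (intro mult_nonneg_nonpos) auto
  moreover have "s powr (2 * (\<epsilon> * real m)) * \<kappa> ^ m = exp (real m * (2 * \<epsilon> * ln s + ln \<kappa>))"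
    using s_gt_1 \<kappa>_bounds
    by (simp add: powr_def exp_of_nat_mult[symmetric] exp_add[symmetric] powr_realpow[symmetric] algebra_simps)
  ultimately show ?thesis by simp
qed

text \<open>Borel-Cantelli applied to the events that the lead has lasted up to \<open>n + j\<close>
  but is at most \<open>\<epsilon> * \<tau>\<close> one step later. On \<open>forever n\<close> only
  the second condition can fail.\<close>

lemma forever_dominates:
  assumes n: "n1 \<le> n"
  shows "AE \<omega> in M. \<omega> \<in> forever n \<longrightarrow> (\<exists>N. \<forall>k\<ge>N. leads \<tau> (\<lambda>i. \<epsilon> * real (\<tau> i)) R B k \<omega>)"
proof -
  define F where "F j = stay n (n + j) \<inter> {\<omega>\<in>space M.
    (real (R (Suc (n + j)) \<omega>) - real (B (Suc (n + j)) \<omega>)) / 2 \<le> \<epsilon> * real (\<tau> (Suc (n + j)))}" for j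
  have Fev: "F j \<in> events" for j
    unfolding F_def
    using events_state[of "\<lambda>r b _ _. (real r - real b) / 2 \<le> \<epsilon> * real (\<tau> (Suc (n + j)))" "Suc (n + j)" "Suc (n + j)"]
    by (intro sets.Int past_events[OF stay_past])
  have le: "prob (F j) \<le> (1 / q ^ \<tau> n) * \<kappa> ^ j" for j
  proof -
    let ?t = "\<tau> (Suc (n + j))"
    have t: "\<tau> n \<le> ?t" "j \<le> ?t" using \<tau>_diff_ge[of j n] by auto
    have "space M \<inter> F j = F j" by (auto simp: F_def)
    then have "prob (F j) \<le> s powr (2 * (\<epsilon> * real ?t)) * q ^ (?t - \<tau> n) * s powr (- 2 * sqrt (real (\<sigma> n))) * prob (space M)"
      using lead_prob[OF past_space n, of j "\<epsilon> * real ?t"] by (simp add: F_def Int_assoc)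
    also have "\<dots> \<le> s powr (2 * (\<epsilon> * real ?t)) * q ^ (?t - \<tau> n) * 1 * 1"
    proof (intro mult_mono order_refl)
      show "s powr (- 2 * sqrt (real (\<sigma> n))) \<le> 1"
        using s_gt_1 powr_mono[of "- 2 * sqrt (real (\<sigma> n))" 0 s] by simp
    qed (use q_bounds in auto)
    also have "\<dots> = (1 / q ^ \<tau> n) * (s powr (2 * (\<epsilon> * real ?t)) * \<kappa> ^ ?t * \<kappa> ^ ?t)"
    proof -
      have "q ^ (?t - \<tau> n) = q ^ ?t / q ^ \<tau> n" using t q_bounds by (simp add: power_diff)
      moreover have "q ^ ?t = \<kappa> ^ ?t * \<kappa> ^ ?t" by (simp add: q_eq power_mult_distrib)
      ultimately show ?thesis by simp
    qed
    also have "\<dots> \<le> (1 / q ^ \<tau> n) * (1 * \<kappa> ^ j)"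
      using powr_\<epsilon>[of ?t] q_bounds \<kappa>_bounds t
      by (intro mult_left_mono mult_mono power_decreasing) auto
    finally show ?thesis by simp
  qed
  have "summable (\<lambda>j. (1 / q ^ \<tau> n) * \<kappa> ^ j)"
    using \<kappa>_bounds by (intro summable_mult summable_geometric) simp
  then have "summable (\<lambda>j. prob (F j))"
    by (rule summable_comparison_test'[where N=0]) (use le in auto)
  then have "AE \<omega> in M. eventually (\<lambda>j. \<omega> \<in> space M - F j) sequentially"
    by (intro borel_cantelli_AE1 Fev) (auto simp: emeasure_eq_measure)
  then show ?thesis using AE_total AE_space
  proof eventually_elim
    case (elim \<omega>)
    then obtain j0 where j0: "\<And>j. j0 \<le> j \<Longrightarrow> \<omega> \<notin> F j" by (auto simp: eventually_sequentially)
    have "leads \<tau> (\<lambda>i. \<epsilon> * real (\<tau> i)) R B k \<omega>" if "\<omega> \<in> forever n" "k \<ge> Suc (n + j0)" for k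
    proof -
      define j where "j = k - Suc n"
      have k: "k = Suc (n + j)" "j0 \<le> j" using that by (auto simp: j_def)
      have "\<omega> \<in> stay n (n + j)" using that(1) by (auto simp: forever_eq)
      then show ?thesis using j0[OF k(2)] elim by (auto simp: F_def k(1) leads_def)
    qed
    then show ?case by blast
  qed
qed

text \<open>One large step creates the lead with probability at least
  \<open>exp (-1024) / 4\<close>, and keeping it forever costs a further factor of two.\<close>

lemma leader_dominates:
  obtains L where "\<And>n A. n1 \<le> n \<Longrightarrow> L \<le> \<sigma> (Suc n) \<Longrightarrow> past n A \<Longrightarrow> (\<And>\<omega>. \<omega> \<in> A \<Longrightarrow> B n \<omega> \<le> R n \<omega>) \<Longrightarrow>
    exp (-1024) / 8 * prob A
      \<le> prob (A \<inter> {\<omega>\<in>space M. \<exists>N. \<forall>k\<ge>N. leads \<tau> (\<lambda>i. \<epsilon> * real (\<tau> i)) R B k \<omega>})"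
proof -
  obtain L where L: "\<And>n A. n1 \<le> n \<Longrightarrow> L \<le> \<sigma> n \<Longrightarrow> past n A \<Longrightarrow> (\<And>\<omega>. \<omega> \<in> A \<Longrightarrow> ahead n \<omega>) \<Longrightarrow>
    prob A / 2 \<le> prob (A \<inter> forever n)"
    using stay_forever by blast
  define G where "G = {\<omega>\<in>space M. \<exists>N. \<forall>k\<ge>N. leads \<tau> (\<lambda>i. \<epsilon> * real (\<tau> i)) R B k \<omega>}"
  have Gev: "G \<in> events"
    unfolding G_def using leads_past[OF order_refl, of _ "\<lambda>i. \<epsilon> * real (\<tau> i)"] past_events by measurable
  \<comment> \<open>The threshold \<open>L\<close> is for persistence of the lead, 4096 for
    anticoncentration.\<close>
  have "exp (-1024) / 8 * prob A \<le> prob (A \<inter> G)"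
    if n: "n1 \<le> n" and \<sigma>: "max L 4096 \<le> \<sigma> (Suc n)" and A: "past n A" and le: "\<And>\<omega>. \<omega> \<in> A \<Longrightarrow> B n \<omega> \<le> R n \<omega>" for n A
  proof -
    define A1 where "A1 = A \<inter> {\<omega>\<in>space M. ahead (Suc n) \<omega>}"
    have A1: "past (Suc n) A1"
      unfolding A1_def by (intro past_Int past_mono[OF A] leads_past) auto
    have "exp (-1024) / 4 * prob A \<le> prob A1"
      unfolding A1_def using \<sigma> by (intro spread A le) auto
    also have "prob A1 / 2 \<le> prob (A1 \<inter> forever (Suc n))"
      using n \<sigma> A1 by (intro L) (auto simp: A1_def)
    then have "prob A1 \<le> 2 * prob (A1 \<inter> forever (Suc n))" by simp
    also have "prob (A1 \<inter> forever (Suc n)) \<le> prob (A \<inter> G)"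
    proof (rule finite_measure_mono_AE)
      show "AE \<omega> in M. \<omega> \<in> A1 \<inter> forever (Suc n) \<longrightarrow> \<omega> \<in> A \<inter> G"
        using forever_dominates[of "Suc n"] n AE_space by (auto simp: A1_def G_def)
      show "A \<inter> G \<in> events" using past_events[OF A] Gev by auto
    qed
    finally show ?thesis by simp
  qed
  then show ?thesis using that[of "max L 4096"] unfolding G_def by blast
qed

end

subsection \<open>Final counts\<close>

text \<open>Finite points of \<open>enat\<close> are isolated, so convergence to one means being
  eventually constant.\<close>

lemma tendsto_enat_const_iff:
  "(\<lambda>n. enat (x n)) \<longlonglongrightarrow> enat K \<longleftrightarrow> (\<exists>N. \<forall>n\<ge>N. x n = K)"
proof
  assume "(\<lambda>n. enat (x n)) \<longlonglongrightarrow> enat K"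
  then have "\<forall>\<^sub>F n in sequentially. enat (x n) \<in> {enat K}"
    by (rule topological_tendstoD) (auto simp: open_enat_iff)
  then show "\<exists>N. \<forall>n\<ge>N. x n = K" by (auto simp: eventually_sequentially)
next
  assume "\<exists>N. \<forall>n\<ge>N. x n = K"
  then have "\<forall>\<^sub>F n in sequentially. enat (x n) = enat K" by (auto simp: eventually_sequentially)
  then show "(\<lambda>n. enat (x n)) \<longlonglongrightarrow> enat K" by (rule tendsto_eventually)
qed

lemma tendsto_enat_infinity_iff:
  "(\<lambda>n. enat (x n)) \<longlonglongrightarrow> \<infinity> \<longleftrightarrow> (\<forall>K. \<exists>N. \<forall>n\<ge>N. K \<le> x n)"
proof
  assume lim: "(\<lambda>n. enat (x n)) \<longlonglongrightarrow> \<infinity>"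
  show "\<forall>K. \<exists>N. \<forall>n\<ge>N. K \<le> x n"
  proof
    fix K
    have "\<forall>\<^sub>F n in sequentially. enat K < enat (x n)"
      using order_tendstoD(1)[OF lim, of "enat K"] by simp
    then show "\<exists>N. \<forall>n\<ge>N. K \<le> x n" by (auto simp: eventually_sequentially intro: less_imp_le)
  qed
next
  assume *: "\<forall>K. \<exists>N. \<forall>n\<ge>N. K \<le> x n"
  show "(\<lambda>n. enat (x n)) \<longlonglongrightarrow> \<infinity>"
  proof (rule order_tendstoI)
    fix a :: enat assume "a < \<infinity>"
    then obtain k where k: "a = enat k" by (cases a) auto
    obtain N where "\<forall>n\<ge>N. Suc k \<le> x n" using * by blast
    then show "\<forall>\<^sub>F n in sequentially. a < enat (x n)"
      unfolding k eventually_sequentially by (auto simp: Suc_le_eq)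
  qed auto
qed

text \<open>
  A divergent sequence has the junk limit \<open>THE L. False\<close>, which must be carried along because
  measurability concerns all of the sample space.
\<close>

lemma lim_enat_finite_iff:
  "lim (\<lambda>n. enat (x n)) < \<infinity> \<longleftrightarrow> (\<exists>K N. \<forall>n\<ge>N. x n = K) \<or>
    \<not> (\<exists>K N. \<forall>n\<ge>N. x n = K) \<and> \<not> (\<forall>K. \<exists>N. \<forall>n\<ge>N. K \<le> x n) \<and> (THE L :: enat. False) < \<infinity>"
proof (cases "\<exists>L. (\<lambda>n. enat (x n)) \<longlonglongrightarrow> L")
  case True
  then obtain L where L: "(\<lambda>n. enat (x n)) \<longlonglongrightarrow> L" by blast
  then have lim: "lim (\<lambda>n. enat (x n)) = L" by (rule limI)
  show ?thesis
  proof (cases L)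
    case (enat K)
    then have "\<exists>K N. \<forall>n\<ge>N. x n = K" using L tendsto_enat_const_iff[of x K] by blast
    then show ?thesis using enat lim by simp
  next
    case infinity
    have "\<not> (\<exists>N. \<forall>n\<ge>N. x n = K)" for K
      using L infinity LIMSEQ_unique[of "\<lambda>n. enat (x n)" \<infinity> "enat K"] tendsto_enat_const_iff[of x K] by auto
    then show ?thesis using L infinity lim tendsto_enat_infinity_iff[of x] by auto
  qed
next
  case False
  then have lim: "lim (\<lambda>n. enat (x n)) = (THE L :: enat. False)" by (simp add: lim_def)
  have "\<not> (\<exists>K N. \<forall>n\<ge>N. x n = K)" "\<not> (\<forall>K. \<exists>N. \<forall>n\<ge>N. K \<le> x n)"
    using False tendsto_enat_const_iff[of x] tendsto_enat_infinity_iff[of x] by auto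
  then show ?thesis unfolding lim by blast
qed

lemma lim_enat_bounded:
  assumes "mono x" "\<And>n. x n \<le> K"
  shows "lim (\<lambda>n. enat (x n)) < \<infinity>"
proof -
  obtain L where L: "(\<lambda>n. enat (x n)) \<longlonglongrightarrow> L"
    by (rule lim_increasing_cl[of "\<lambda>n. enat (x n)"]) (use assms(1) in \<open>auto simp: mono_def\<close>)
  have "L \<le> enat K" using L by (rule LIMSEQ_le_const2) (use assms in auto)
  then have "L < \<infinity>" by (rule le_less_trans) simp
  then show ?thesis using limI[OF L] by simp
qed

subsection \<open>Boundedness of the minority\<close>

lemma sum_blocks:
  fixes b :: "nat \<Rightarrow> nat" and g :: "nat \<Rightarrow> real"
  assumes "mono b"
  shows "(\<Sum>l<j. \<Sum>i\<in>{b (n + l)..<b (Suc (n + l))}. g i) = (\<Sum>i\<in>{b n..<b (n + j)}. g i)"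
proof (induction j)
  case (Suc j)
  have "b n \<le> b (n + j)" "b (n + j) \<le> b (Suc (n + j))" using assms by (auto intro: monoD)
  then show ?case using Suc by (simp add: sum.atLeastLessThan_concat)
qed simp

context gpu_process
begin

text \<open>Rewriting finiteness of the limit with countable quantifiers over the counts makes it
  visibly measurable.\<close>

lemma final_count_events: "{\<omega>\<in>space M. final_count R \<omega> < \<infinity>} \<in> events"
  unfolding final_count_def lim_enat_finite_iff by measurable

text \<open>Each new blue ball adds at most \<open>1 / w b\<close>, and the expected number of blue
  balls is \<open>m * w b / (w r + w b)\<close>. The factor \<open>w b\<close> cancels, and
  \<open>w r\<close> alone is at least \<open>lin_interp w x\<close>.\<close>

lemma minority_step:
  assumes A: "past n A" and x: "0 \<le> x" "\<And>\<omega>. \<omega> \<in> A \<Longrightarrow> x \<le> real (R n \<omega>)"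
  shows "(\<integral>\<^sup>+\<omega>\<in>A. ennreal (\<Sum>i\<in>{B n \<omega>..<B (Suc n) \<omega>}. 1 / w i) \<partial>M)
    \<le> ennreal (real (\<sigma> (Suc n)) / lin_interp w x) * emeasure M A"
proof -
  define m where "m = \<sigma> (Suc n)"
  have W: "0 < lin_interp w x" using lin_interp_ge[OF w_mono, of 0 x] x(1) w_pos[of 0] by simp
  have "(\<integral>\<^sup>+\<omega>\<in>A. ennreal (\<Sum>i\<in>{B n \<omega>..<B (Suc n) \<omega>}. 1 / w i) \<partial>M)
    = (\<integral>\<^sup>+\<omega>\<in>A. (\<integral>\<^sup>+k. ennreal (\<Sum>i\<in>{B n \<omega>..<B n \<omega> + m - k}. 1 / w i)
      \<partial>binomial_pmf m (red_prob (R n \<omega>) (B n \<omega>))) \<partial>M)"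
    unfolding m_def by (rule nn_integral_step[OF A, where f="\<lambda>_ b _ b'. ennreal (\<Sum>i\<in>{b..<b'}. 1 / w i)"])
  also have "\<dots> \<le> (\<integral>\<^sup>+\<omega>\<in>A. ennreal (real m / lin_interp w x) \<partial>M)"
  proof (rule nn_integral_mono)
    fix \<omega>
    define r b p where "r = R n \<omega>" and "b = B n \<omega>" and "p = red_prob r b"
    have "(\<integral>\<^sup>+k. ennreal (\<Sum>i\<in>{b..<b + m - k}. 1 / w i) \<partial>binomial_pmf m p) \<le> ennreal (real m / lin_interp w x)"
      if "\<omega> \<in> A"
    proof -
      have p: "0 < p" "p < 1" using red_prob_bounds by (auto simp: p_def)
      have "(\<integral>\<^sup>+k. ennreal (\<Sum>i\<in>{b..<b + m - k}. 1 / w i) \<partial>binomial_pmf m p)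
        \<le> (\<integral>\<^sup>+k. ennreal (1 / w b) * ennreal (real (m - k)) \<partial>binomial_pmf m p)"
      proof (rule nn_integral_mono_AE, unfold AE_measure_pmf_iff, intro ballI)
        fix k assume "k \<in> set_pmf (binomial_pmf m p)"
        then have "k \<le> m" using p by simp
        have "(\<Sum>i\<in>{b..<b + m - k}. 1 / w i) \<le> real (card {b..<b + m - k}) * (1 / w b)"
          using w_pos monoD[OF w_mono] by (intro sum_bounded_above divide_left_mono) auto
        also have "\<dots> = 1 / w b * real (m - k)" using \<open>k \<le> m\<close> by simp
        finally show "ennreal (\<Sum>i\<in>{b..<b + m - k}. 1 / w i) \<le> ennreal (1 / w b) * ennreal (real (m - k))"
          using w_pos[of b] by (subst ennreal_mult[symmetric]) (auto intro: ennreal_leI)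
      qed
      also have "\<dots> = ennreal (1 / w b) * ennreal (real m * (1 - p))"
        using p by (simp add: nn_integral_cmult nn_integral_binomial_pmf_failures)
      also have "\<dots> = ennreal (real m / (w r + w b))"
      proof -
        have "1 / w b * (real m * (1 - p)) = real m / (w r + w b)"
          using w_pos[of b] w_pos[of r] by (simp add: p_def red_prob_def field_simps)
        then show ?thesis using w_pos[of b] p by (simp add: ennreal_mult[symmetric])
      qed
      also have "\<dots> \<le> ennreal (real m / lin_interp w x)"
      proof (intro ennreal_leI divide_left_mono mult_pos_pos W)
        show "lin_interp w x \<le> w r + w b"
          using w_pos[of b] lin_interp_le[OF w_mono x(1) x(2)[OF that]] by (simp add: r_def)
        show "0 < w r + w b" using w_pos[of r] w_pos[of b] by simp
      qed simp
      finally show ?thesis .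
    qed
    then show "(\<integral>\<^sup>+k. ennreal (\<Sum>i\<in>{B n \<omega>..<B n \<omega> + m - k}. 1 / w i)
        \<partial>binomial_pmf m (red_prob (R n \<omega>) (B n \<omega>))) * indicator A \<omega>
      \<le> ennreal (real m / lin_interp w x) * indicator A \<omega>"
      by (auto simp: r_def b_def p_def split: split_indicator)
  qed
  also have "\<dots> = ennreal (real m / lin_interp w x) * emeasure M A"
    using past_events[OF A] by (rule nn_integral_cmult_indicator)
  finally show ?thesis by (simp add: m_def)
qed

text \<open>On \<open>E\<close> blue starts at most at \<open>f\<close> and passes every level, so
  the terms \<open>T\<close> sum to at least \<open>\<theta>\<close>; their expected sum is at most
  \<open>\<theta> / 4\<close> times the probability of \<open>A\<close>. Since \<open>E\<close>
  depends on the future, the lead is imposed step by step through \<open>L (n + i)\<close>, which is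
  known at step \<open>n + i\<close>.\<close>

lemma minority_conditional:
  assumes \<epsilon>: "0 < \<epsilon>" "\<epsilon> < 1/2" and summ: "summable (\<lambda>n. 1 / w n)"
    and tail: "(\<Sum>i. ennreal (real (\<sigma> (n + i + 1)) / lin_interp w ((1/2 + \<epsilon>) * real (\<tau> (n + i)))))
          \<le> ennreal (1/4) * (\<Sum>i. ennreal (1 / w (nat \<lfloor>(1/2 - \<epsilon>) * real (\<tau> n)\<rfloor> + i)))"
    and A: "past n A" and E: "E \<in> events"
    and E_leads: "\<And>\<omega> k. \<omega> \<in> E \<Longrightarrow> n \<le> k \<Longrightarrow> leads \<tau> (\<lambda>i. \<epsilon> * real (\<tau> i)) R B k \<omega>"
    and E_unbounded: "\<And>\<omega> K. \<omega> \<in> E \<Longrightarrow> \<exists>k. K \<le> B k \<omega>"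
  shows "prob (A \<inter> E) \<le> 1/4 * prob A"
proof -
  define L where "L k = {\<omega>\<in>space M. leads \<tau> (\<lambda>i. \<epsilon> * real (\<tau> i)) R B k \<omega>}" for k
  define T where "T k \<omega> = ennreal (\<Sum>i\<in>{B k \<omega>..<B (Suc k) \<omega>}. 1 / w i)" for k \<omega>
  define f where "f = nat \<lfloor>(1/2 - \<epsilon>) * real (\<tau> n)\<rfloor>"
  define \<theta> where "\<theta> = (\<Sum>i. ennreal (1 / w (f + i)))"
  have pL: "past k (L k)" for k unfolding L_def by (rule leads_past) simp
  have pAL: "past (n + i) (A \<inter> L (n + i))" for i
    by (intro past_Int past_mono[OF A] pL) simp
  have T_meas: "T k \<in> borel_measurable M" for k
    unfolding T_def using borel_fun_state[of "\<lambda>_ b _ b'. ennreal (\<Sum>i\<in>{b..<b'}. 1 / w i)" k "Suc k"] .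
  have AE_E: "A \<inter> E \<in> events" using past_events[OF A] E by auto
  have summ_f: "summable (\<lambda>i. 1 / w (f + i))"
    using summable_ignore_initial_segment[OF summ, of f] by (simp add: add.commute)
  have \<theta>_eq: "\<theta> = ennreal (\<Sum>i. 1 / w (f + i))"
    unfolding \<theta>_def using summ_f w_pos by (intro suminf_ennreal2) (auto intro: less_imp_le)
  have "0 < (\<Sum>i. 1 / w (f + i))" using summ_f w_pos by (intro suminf_pos) auto
  \<comment> \<open>Being positive and finite allows \<open>\<theta>\<close> to be cancelled at the
    end.\<close>
  then have \<theta>: "\<theta> \<noteq> 0" "\<theta> \<noteq> \<top>" unfolding \<theta>_eq by auto
  have lower: "\<theta> * indicator (A \<inter> E) \<omega> \<le> (\<Sum>i. T (n + i) \<omega> * indicator (A \<inter> L (n + i)) \<omega>)"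
    if B_mono: "mono (\<lambda>n. B n \<omega>)" and \<omega>: "\<omega> \<in> space M" for \<omega>
  proof (cases "\<omega> \<in> A \<inter> E")
    case True
    then have in_L: "\<omega> \<in> A \<inter> L (n + i)" for i using E_leads[of \<omega> "n + i"] \<omega> by (auto simp: L_def)
    have "leads \<tau> (\<lambda>i. \<epsilon> * real (\<tau> i)) R B n \<omega>" using E_leads[of \<omega> n] True by auto
    then have "real (B n \<omega>) \<le> (1/2 - \<epsilon>) * real (\<tau> n)"
      unfolding leads_def by (simp add: algebra_simps flip: of_nat_add)
    then have Bf: "B n \<omega> \<le> f" unfolding f_def by (simp add: le_nat_floor)
    have "(\<Sum>i<K. ennreal (1 / w (f + i))) \<le> (\<Sum>i. T (n + i) \<omega>)" for K
    proof -
      obtain k where k: "f + K \<le> B k \<omega>" using E_unbounded[of \<omega>] True by blast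
      then have k': "f + K \<le> B (n + k) \<omega>" using monoD[OF B_mono, of k "n + k"] by simp
      have "(\<Sum>i<K. 1 / w (f + i)) = (\<Sum>i\<in>{f..<f + K}. 1 / w i)"
        using sum.shift_bounds_nat_ivl[of "\<lambda>i. 1 / w i" 0 f K] by (simp add: atLeast0LessThan add.commute)
      also have "\<dots> \<le> (\<Sum>i\<in>{B n \<omega>..<B (n + k) \<omega>}. 1 / w i)"
        using Bf k' w_pos by (intro sum_mono2) (auto intro: less_imp_le)
      also have "\<dots> = (\<Sum>l<k. \<Sum>i\<in>{B (n + l) \<omega>..<B (Suc (n + l)) \<omega>}. 1 / w i)"
        using sum_blocks[OF B_mono, where j=k and n=n and g="\<lambda>i. 1 / w i"] by simp
      finally have "ennreal (\<Sum>i<K. 1 / w (f + i))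
          \<le> ennreal (\<Sum>l<k. \<Sum>i\<in>{B (n + l) \<omega>..<B (Suc (n + l)) \<omega>}. 1 / w i)"
        by (rule ennreal_leI)
      moreover have "(\<Sum>i<K. ennreal (1 / w (f + i))) = ennreal (\<Sum>i<K. 1 / w (f + i))"
        using w_pos by (intro sum_ennreal) (simp add: less_imp_le)
      moreover have "(\<Sum>l<k. T (n + l) \<omega>)
          = ennreal (\<Sum>l<k. \<Sum>i\<in>{B (n + l) \<omega>..<B (Suc (n + l)) \<omega>}. 1 / w i)"
        unfolding T_def using w_pos by (intro sum_ennreal sum_nonneg) (simp add: less_imp_le)
      ultimately have "(\<Sum>i<K. ennreal (1 / w (f + i))) \<le> (\<Sum>l<k. T (n + l) \<omega>)" by simp
      also have "\<dots> \<le> (\<Sum>i. T (n + i) \<omega>)" by (rule sum_le_suminf) auto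
      finally show ?thesis .
    qed
    then have "\<theta> \<le> (\<Sum>i. T (n + i) \<omega>)" unfolding \<theta>_def by (intro suminf_le_const) auto
    then show ?thesis using True in_L by simp
  qed simp
  have "\<theta> * emeasure M (A \<inter> E) = (\<integral>\<^sup>+\<omega>. \<theta> * indicator (A \<inter> E) \<omega> \<partial>M)"
    using AE_E by (rule nn_integral_cmult_indicator[symmetric])
  also have "\<dots> \<le> (\<integral>\<^sup>+\<omega>. (\<Sum>i. T (n + i) \<omega> * indicator (A \<inter> L (n + i)) \<omega>) \<partial>M)"
  proof (rule nn_integral_mono_AE)
    show "AE \<omega> in M. \<theta> * indicator (A \<inter> E) \<omega> \<le> (\<Sum>i. T (n + i) \<omega> * indicator (A \<inter> L (n + i)) \<omega>)"
      using gpu_process.AE_mono[OF swap] AE_space by eventually_elim (rule lower)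
  qed
  also have "\<dots> = (\<Sum>i. \<integral>\<^sup>+\<omega>\<in>A \<inter> L (n + i). T (n + i) \<omega> \<partial>M)"
    using T_meas past_events[OF pAL] by (intro nn_integral_suminf borel_measurable_times_ennreal) auto
  also have "\<dots> \<le> (\<Sum>i. ennreal (real (\<sigma> (n + i + 1)) / lin_interp w ((1/2 + \<epsilon>) * real (\<tau> (n + i)))) * emeasure M A)"
  proof (intro suminf_le allI)
    fix i
    have "(\<integral>\<^sup>+\<omega>\<in>A \<inter> L (n + i). T (n + i) \<omega> \<partial>M)
      \<le> ennreal (real (\<sigma> (Suc (n + i))) / lin_interp w ((1/2 + \<epsilon>) * real (\<tau> (n + i)))) * emeasure M (A \<inter> L (n + i))"
      unfolding T_def
    proof (rule minority_step[OF pAL])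
      fix \<omega> assume "\<omega> \<in> A \<inter> L (n + i)"
      then have "leads \<tau> (\<lambda>i. \<epsilon> * real (\<tau> i)) R B (n + i) \<omega>" by (simp add: L_def)
      then show "(1/2 + \<epsilon>) * real (\<tau> (n + i)) \<le> real (R (n + i) \<omega>)"
        unfolding leads_def by (simp add: algebra_simps flip: of_nat_add)
    qed (use \<epsilon> in simp)
    also have "\<dots> \<le> ennreal (real (\<sigma> (Suc (n + i))) / lin_interp w ((1/2 + \<epsilon>) * real (\<tau> (n + i)))) * emeasure M A"
      using past_events[OF A] by (intro mult_left_mono emeasure_mono) auto
    finally show "(\<integral>\<^sup>+\<omega>\<in>A \<inter> L (n + i). T (n + i) \<omega> \<partial>M)
      \<le> ennreal (real (\<sigma> (n + i + 1)) / lin_interp w ((1/2 + \<epsilon>) * real (\<tau> (n + i)))) * emeasure M A"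
      by simp
  qed auto
  also have "\<dots> = (\<Sum>i. ennreal (real (\<sigma> (n + i + 1)) / lin_interp w ((1/2 + \<epsilon>) * real (\<tau> (n + i))))) * emeasure M A"
    by (rule ennreal_suminf_multc)
  also have "\<dots> \<le> (ennreal (1/4) * \<theta>) * emeasure M A"
    using tail unfolding \<theta>_def f_def by (rule mult_right_mono) simp
  also have "\<dots> = \<theta> * (ennreal (1/4) * emeasure M A)" by (simp add: mult_ac)
  finally have "emeasure M (A \<inter> E) \<le> ennreal (1/4) * emeasure M A"
    using \<theta> by (subst (asm) ennreal_mult_le_mult_iff) auto
  then show ?thesis by (simp add: emeasure_eq_measure ennreal_mult[symmetric] del: ennreal_1 ennreal_numeral)
qed

text \<open>For each \<open>N\<close> the event that red dominates from \<open>N\<close> on while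
  blue is unbounded has conditional probability at most \<open>1/4\<close> given any past, and is
  therefore null.\<close>

lemma minority_bounded:
  assumes \<epsilon>: "0 < \<epsilon>" "\<epsilon> < 1/2" and summ: "summable (\<lambda>n. 1 / w n)"
    and tail: "\<And>n. n0 \<le> n \<Longrightarrow>
        (\<Sum>i. ennreal (real (\<sigma> (n + i + 1)) / lin_interp w ((1/2 + \<epsilon>) * real (\<tau> (n + i)))))
          \<le> ennreal (1/4) * (\<Sum>i. ennreal (1 / w (nat \<lfloor>(1/2 - \<epsilon>) * real (\<tau> n)\<rfloor> + i)))"
  shows "AE \<omega> in M. (\<exists>N. \<forall>k\<ge>N. leads \<tau> (\<lambda>i. \<epsilon> * real (\<tau> i)) R B k \<omega>) \<longrightarrow> (\<exists>K. \<forall>k. B k \<omega> \<le> K)"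
proof -
  let ?l = "\<lambda>i \<omega>. leads \<tau> (\<lambda>i. \<epsilon> * real (\<tau> i)) R B i \<omega>"
  \<comment> \<open>Both requirements are truncated: dominance is checked up to \<open>m\<close>,
    and level \<open>m\<close> must be reached by step \<open>k\<close>. The result is known at step
    \<open>max m k\<close>, increasing in \<open>k\<close> and decreasing in
    \<open>m\<close>.\<close>
  define E where "E N m k = {\<omega>\<in>space M. \<forall>i\<in>{N..m}. ?l i \<omega>} \<inter> {\<omega>\<in>space M. \<exists>j\<in>{..k}. m \<le> B j \<omega>}" for N m k
  have pE: "past (max m k) (E N m k)" for N m k
    unfolding E_def
  proof (intro past_Int past_Ball past_Bex leads_past)
    show "past (max m k) {\<omega>\<in>space M. m \<le> B j \<omega>}" if "j \<in> {..k}" for j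
      using events_state[of "\<lambda>_ b _ _. m \<le> b" j j] that by (intro past_Collect) auto
  qed auto
  have null: "prob (\<Inter>m. \<Union>k. E N m k) = 0" for N
  proof (rule null_if_uniformly_avoided[where N=max and E="E N" and q="1/4"])
    show "incseq (E N m)" for m by (force simp: incseq_def E_def)
    show "decseq (\<lambda>m. E N m k)" for k
      unfolding decseq_def E_def by (fastforce intro: order_trans)
    fix n A assume A: "past n A"
    \<comment> \<open>The given past is enlarged to a step at which red already dominates and (iii)
      is in force.\<close>
    define n' where "n' = max n (max N n0)"
    show "prob (A \<inter> (\<Inter>m. \<Union>k. E N m k)) \<le> 1/4 * prob A"
    proof (rule minority_conditional[OF \<epsilon> summ tail past_mono[OF A]])
      show "n0 \<le> n'" "n \<le> n'" by (auto simp: n'_def)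
      show "(\<Inter>m. \<Union>k. E N m k) \<in> events" using past_events[OF pE] by auto
      fix \<omega> assume \<omega>: "\<omega> \<in> (\<Inter>m. \<Union>k. E N m k)"
      show "?l k \<omega>" if "n' \<le> k" for k
      proof -
        have "\<omega> \<in> (\<Union>j. E N k j)" using \<omega> by blast
        then show ?thesis using that by (auto simp: E_def n'_def)
      qed
      show "\<exists>k. K \<le> B k \<omega>" for K
      proof -
        have "\<omega> \<in> (\<Union>j. E N K j)" using \<omega> by blast
        then show ?thesis by (auto simp: E_def)
      qed
    qed
  qed (use pE in auto)
  have "AE \<omega> in M. \<omega> \<notin> (\<Inter>m. \<Union>k. E N m k)" for N
    using null[of N] past_events[OF pE] by (intro AE_not_in) (auto simp: null_sets_def emeasure_eq_measure)
  then have "AE \<omega> in M. \<forall>N. \<omega> \<notin> (\<Inter>m. \<Union>k. E N m k)" by (simp add: AE_all_countable)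
  then show ?thesis using AE_space
  proof eventually_elim
    case (elim \<omega>)
    show ?case
    proof
      assume "\<exists>N. \<forall>k\<ge>N. ?l k \<omega>"
      then obtain N where N: "\<And>k. N \<le> k \<Longrightarrow> ?l k \<omega>" by blast
      obtain m where m: "\<And>k. \<omega> \<notin> E N m k" using elim by blast
      have "B j \<omega> \<le> m" for j
      proof -
        have "\<omega> \<in> E N m j" if "m \<le> B j \<omega>"
          using that N elim(2) unfolding E_def by auto
        then show ?thesis using m[of j] by linarith
      qed
      then show "\<exists>K. \<forall>k. B k \<omega> \<le> K" by blast
    qed
  qed
qed

end

section \<open>Combining the two colours\<close>

text \<open>Any \<open>\<rho>\<close> strictly between 1 and the limit inferior works. The same pair
  serves both colours because (ii) involves only the total, which is symmetric in \<open>r0\<close>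
  and \<open>b0\<close>.\<close>

lemma gpu_bias_exists:
  assumes "gpu_process M w \<sigma> r0 b0 R B"
    and ii: "liminf (\<lambda>n. ereal (lin_interp w (real (total_balls r0 b0 \<sigma> n) / 2 + sqrt (real (\<sigma> n)))
                              / lin_interp w (real (total_balls r0 b0 \<sigma> n) / 2))) > 1"
  obtains \<rho> n1 where "gpu_bias M w \<sigma> r0 b0 R B \<rho> n1" "gpu_bias M w \<sigma> b0 r0 B R \<rho> n1"
proof -
  interpret gpu_process M w \<sigma> r0 b0 R B by fact
  obtain \<rho> where \<rho>: "1 < ereal \<rho>" "ereal \<rho> < liminf (\<lambda>n. ereal (lin_interp w (real (\<tau> n) / 2 + sqrt (real (\<sigma> n)))
                              / lin_interp w (real (\<tau> n) / 2)))"
    using ereal_dense2[OF ii] by blast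
  obtain n1 where n1: "\<And>n. n1 \<le> n \<Longrightarrow> \<rho> < lin_interp w (real (\<tau> n) / 2 + sqrt (real (\<sigma> n))) / lin_interp w (real (\<tau> n) / 2)"
    using less_LiminfD[OF \<rho>(2)] by (auto simp: eventually_sequentially)
  have *: "\<rho> * lin_interp w (real (\<tau> n) / 2) \<le> lin_interp w (real (\<tau> n) / 2 + sqrt (real (\<sigma> n)))" if "n1 \<le> n" for n
  proof -
    have "0 < lin_interp w (real (\<tau> n) / 2)"
      using lin_interp_ge[OF w_mono, of 0 "real (\<tau> n) / 2"] w_pos[of 0] by simp
    then show ?thesis using n1[OF that] by (simp add: field_simps)
  qed
  have "gpu_bias M w \<sigma> r0 b0 R B \<rho> n1"
    using \<rho>(1) * by unfold_locales auto
  moreover have "gpu_bias M w \<sigma> b0 r0 B R \<rho> n1"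
    using \<rho>(1) * by (intro gpu_bias.intro swap gpu_bias_axioms.intro) (auto simp: total_balls_commute[of b0])
  ultimately show ?thesis by (rule that)
qed

text \<open>Given any past, some later step adds many balls, and whichever colour leads before it
  then dominates with probability at least \<open>c\<close>. Hence the event that neither dominates
  is uniformly avoided.\<close>

lemma one_colour_dominates:
  assumes bias: "gpu_bias M w \<sigma> r0 b0 R B \<rho> n1" and bias': "gpu_bias M w \<sigma> b0 r0 B R \<rho> n1"
    and i: "limsup (\<lambda>n. enat (\<sigma> n)) = \<infinity>"
  defines "l \<equiv> leads (total_balls r0 b0 \<sigma>) (\<lambda>i. gpu_bias.\<epsilon> \<rho> * real (total_balls r0 b0 \<sigma> i))"
  shows "AE \<omega> in M. (\<exists>N. \<forall>k\<ge>N. l R B k \<omega>) \<or> (\<exists>N. \<forall>k\<ge>N. l B R k \<omega>)"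
proof -
  interpret red: gpu_bias M w \<sigma> r0 b0 R B \<rho> n1 by fact
  interpret blue: gpu_bias M w \<sigma> b0 r0 B R \<rho> n1 by fact
  define c :: real where "c = exp (-1024) / 8"
  have past_swap: "blue.past n A \<longleftrightarrow> red.past n A" for n A
    unfolding red.past_def blue.past_def by (simp add: conj_commute)
  define GR where "GR = {\<omega>\<in>space M. \<exists>N. \<forall>k\<ge>N. l R B k \<omega>}"
  define GB where "GB = {\<omega>\<in>space M. \<exists>N. \<forall>k\<ge>N. l B R k \<omega>}"
  obtain L1 where L1: "\<And>n A. n1 \<le> n \<Longrightarrow> L1 \<le> \<sigma> (Suc n) \<Longrightarrow> red.past n A \<Longrightarrow> (\<And>\<omega>. \<omega> \<in> A \<Longrightarrow> B n \<omega> \<le> R n \<omega>) \<Longrightarrow>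
    c * red.prob A \<le> red.prob (A \<inter> GR)"
    using red.leader_dominates unfolding GR_def l_def c_def by blast
  obtain L2 where L2: "\<And>n A. n1 \<le> n \<Longrightarrow> L2 \<le> \<sigma> (Suc n) \<Longrightarrow> red.past n A \<Longrightarrow> (\<And>\<omega>. \<omega> \<in> A \<Longrightarrow> R n \<omega> \<le> B n \<omega>) \<Longrightarrow>
    c * red.prob A \<le> red.prob (A \<inter> GB)"
    using blue.leader_dominates unfolding GB_def l_def c_def past_swap total_balls_commute[of b0] by blast
  have pR: "red.past k {\<omega>\<in>space M. l R B i \<omega>}" and pB: "red.past k {\<omega>\<in>space M. l B R i \<omega>}" if "i \<le> k" for i k
    unfolding l_def using that by (auto intro: red.leads_past red.leads_past_swap)
  have GRev: "GR \<in> red.events" and GBev: "GB \<in> red.events"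
    unfolding GR_def GB_def using red.past_events[OF pR[OF order_refl]] red.past_events[OF pB[OF order_refl]]
    by measurable
  \<comment> \<open>Each colour fails to dominate at some time in the window \<open>{m..k}\<close>;
    letting \<open>k\<close> and then \<open>m\<close> grow gives failure infinitely often for
    both.\<close>
  define E where "E m k = {\<omega>\<in>space M. \<exists>i\<in>{m..k}. \<not> l R B i \<omega>} \<inter> {\<omega>\<in>space M. \<exists>i\<in>{m..k}. \<not> l B R i \<omega>}" for m k
  have pE: "red.past k (E m k)" for m k
    unfolding E_def by (intro red.past_Int red.past_Bex red.past_Not pR pB) auto
  define G where "G = (\<Inter>m. \<Union>k. E m k)"
  have Gev: "G \<in> red.events" unfolding G_def using red.past_events[OF pE] by auto
  have G: "G = space M - (GR \<union> GB)"
  proof (intro equalityI subsetI)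
    fix \<omega> assume \<omega>: "\<omega> \<in> G"
    have "(\<exists>i\<ge>m. \<not> l R B i \<omega>) \<and> (\<exists>i\<ge>m. \<not> l B R i \<omega>)" for m
    proof -
      have "\<omega> \<in> (\<Union>k. E m k)" using \<omega> unfolding G_def by blast
      then show ?thesis by (auto simp: E_def)
    qed
    moreover have "\<omega> \<in> space M" using sets.sets_into_space[OF Gev] \<omega> by blast
    ultimately show "\<omega> \<in> space M - (GR \<union> GB)" unfolding GR_def GB_def by blast
  next
    fix \<omega> assume \<omega>: "\<omega> \<in> space M - (GR \<union> GB)"
    have "\<omega> \<in> (\<Union>k. E m k)" for m
    proof -
      obtain i j where "m \<le> i" "\<not> l R B i \<omega>" "m \<le> j" "\<not> l B R j \<omega>"
        using \<omega> unfolding GR_def GB_def by blast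
      then have "\<omega> \<in> E m (max i j)" using \<omega> unfolding E_def by (auto intro: le_max_iff_disj[THEN iffD2])
      then show ?thesis by blast
    qed
    then show "\<omega> \<in> G" by (simp add: G_def)
  qed
  have "red.prob G = 0"
    unfolding G_def
  proof (rule red.null_if_uniformly_avoided[where N="\<lambda>_ k. k" and q="1 - c"])
    show "incseq (E m)" for m by (fastforce simp: incseq_def E_def)
    show "decseq (\<lambda>m. E m k)" for k by (fastforce simp: decseq_def E_def)
    fix n A assume A: "red.past n A"
    define L where "L = max L1 L2"
    \<comment> \<open>If all later draws were at most \<open>L\<close>, the limit superior in (i)
      would be finite.\<close>
    obtain n' where n': "n' \<ge> max n n1" "L \<le> \<sigma> (Suc n')"
    proof (rule ccontr)
      assume "\<not> thesis"
      then have "\<sigma> (Suc k) \<le> L" if "k \<ge> max n n1" for k using that \<open>\<And>n'. _ \<Longrightarrow> _ \<Longrightarrow> thesis\<close> by force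
      then have "\<sigma> k \<le> L" if "k \<ge> Suc (max n n1)" for k using that by (cases k) auto
      then have "limsup (\<lambda>n. enat (\<sigma> n)) \<le> enat L"
        by (intro Limsup_bounded) (auto simp: eventually_sequentially)
      then show False using i by simp
    qed
    have A': "red.past n' A" using n' by (intro red.past_mono[OF A]) simp
    \<comment> \<open>The past is split according to the leader at step \<open>n'\<close>, with ties
      counted for red; the two bounds are then added.\<close>
    define A1 where "A1 = A \<inter> {\<omega>\<in>space M. B n' \<omega> \<le> R n' \<omega>}"
    define A2 where "A2 = A \<inter> {\<omega>\<in>space M. \<not> B n' \<omega> \<le> R n' \<omega>}"
    have "red.past n' {\<omega>\<in>space M. B n' \<omega> \<le> R n' \<omega>}"
      using red.events_state[of "\<lambda>r b _ _. b \<le> r" n' n'] by (intro red.past_Collect) auto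
    then have A12: "red.past n' A1" "red.past n' A2"
      unfolding A1_def A2_def by (auto intro!: red.past_Int red.past_Not A')
    note ev = red.past_events[OF A] red.past_events[OF A12(1)] red.past_events[OF A12(2)] GRev GBev Gev
    have split: "A = A1 \<union> A2" "A1 \<inter> A2 = {}"
      using sets.sets_into_space[OF ev(1)] by (auto simp: A1_def A2_def)
    have PA: "red.prob A = red.prob A1 + red.prob A2"
      using split ev red.finite_measure_Union[of A1 A2] by simp
    have "c * red.prob A1 \<le> red.prob (A1 \<inter> GR)"
      using n' A12 by (intro L1) (auto simp: A1_def L_def)
    also have "\<dots> \<le> red.prob (A1 \<inter> (GR \<union> GB))"
      using ev by (intro red.finite_measure_mono) auto
    finally have 1: "c * red.prob A1 \<le> red.prob (A1 \<inter> (GR \<union> GB))" .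
    have "c * red.prob A2 \<le> red.prob (A2 \<inter> GB)"
      using n' A12 by (intro L2) (auto simp: A2_def L_def)
    also have "\<dots> \<le> red.prob (A2 \<inter> (GR \<union> GB))"
      using ev by (intro red.finite_measure_mono) auto
    finally have 2: "c * red.prob A2 \<le> red.prob (A2 \<inter> (GR \<union> GB))" .
    have "A \<inter> (GR \<union> GB) = (A1 \<inter> (GR \<union> GB)) \<union> (A2 \<inter> (GR \<union> GB))"
      "(A1 \<inter> (GR \<union> GB)) \<inter> (A2 \<inter> (GR \<union> GB)) = {}" using split by auto
    then have 3: "red.prob (A \<inter> (GR \<union> GB)) = red.prob (A1 \<inter> (GR \<union> GB)) + red.prob (A2 \<inter> (GR \<union> GB))"
      using ev red.finite_measure_Union[of "A1 \<inter> (GR \<union> GB)" "A2 \<inter> (GR \<union> GB)"] by auto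
    have "A = (A \<inter> G) \<union> (A \<inter> (GR \<union> GB))" "(A \<inter> G) \<inter> (A \<inter> (GR \<union> GB)) = {}"
      using sets.sets_into_space[OF ev(1)] unfolding G by auto
    then have 4: "red.prob A = red.prob (A \<inter> G) + red.prob (A \<inter> (GR \<union> GB))"
      using ev red.finite_measure_Union[of "A \<inter> G" "A \<inter> (GR \<union> GB)"] by auto
    have "c * red.prob A = c * red.prob A1 + c * red.prob A2" by (simp only: PA distrib_left)
    moreover have "(1 - c) * red.prob A = red.prob A - c * red.prob A" by (simp add: algebra_simps)
    ultimately show "red.prob (A \<inter> (\<Inter>m. \<Union>k. E m k)) \<le> (1 - c) * red.prob A"
      using 1 2 3 4 unfolding G_def[symmetric] by linarith
  qed (use pE in \<open>auto simp: c_def\<close>)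
  then have "AE \<omega> in M. \<omega> \<notin> G"
    using Gev by (intro AE_not_in) (auto simp: null_sets_def red.emeasure_eq_measure)
  then show ?thesis using AE_space
    by eventually_elim (auto simp: G GR_def GB_def)
qed

theorem theorem4p2:
  fixes M :: "'a measure"
    and w :: "nat \<Rightarrow> real"
    and \<sigma> :: "nat \<Rightarrow> nat"
    and r0 b0 :: nat
    and R B :: "nat \<Rightarrow> 'a \<Rightarrow> nat"
  defines "\<tau> \<equiv> total_balls r0 b0 \<sigma>"
  assumes gpu: "gpu_process M w \<sigma> r0 b0 R B"
    and summ: "summable (\<lambda>n. 1 / w n)"
    and i: "limsup (\<lambda>n. enat (\<sigma> n)) = \<infinity>"
    and ii: "liminf (\<lambda>n. ereal (lin_interp w (real (\<tau> n) / 2 + sqrt (real (\<sigma> n)))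
                              / lin_interp w (real (\<tau> n) / 2))) > 1"
    and iii: "\<And>\<epsilon>::real. 0 < \<epsilon> \<Longrightarrow> \<epsilon> < 1/2 \<Longrightarrow> \<exists>n0. \<forall>n\<ge>n0.
        (\<Sum>i. ennreal (real (\<sigma> (n + i + 1)) / lin_interp w ((1/2 + \<epsilon>) * real (\<tau> (n + i)))))
          \<le> ennreal (1/4) * (\<Sum>i. ennreal (1 / w (nat \<lfloor>(1/2 - \<epsilon>) * real (\<tau> n)\<rfloor> + i)))"
  shows "\<P>(\<omega> in M. final_count R \<omega> < \<infinity> \<or> final_count B \<omega> < \<infinity>) = 1"
proof -
  obtain \<rho> n1 where bias: "gpu_bias M w \<sigma> r0 b0 R B \<rho> n1" and bias': "gpu_bias M w \<sigma> b0 r0 B R \<rho> n1"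
    using gpu_bias_exists[OF gpu ii[unfolded \<tau>_def]] by blast
  interpret red: gpu_bias M w \<sigma> r0 b0 R B \<rho> n1 by fact
  interpret blue: gpu_bias M w \<sigma> b0 r0 B R \<rho> n1 by fact
  \<comment> \<open>This slope depends only on \<open>\<rho>\<close>, so (iii) is invoked once for
    both colours.\<close>
  define \<epsilon> where "\<epsilon> = gpu_bias.\<epsilon> \<rho>"
  have \<epsilon>: "0 < \<epsilon>" "\<epsilon> < 1/2" using red.\<epsilon>_bounds by (auto simp: \<epsilon>_def)
  obtain n0 where n0: "\<And>n. n0 \<le> n \<Longrightarrow>
        (\<Sum>i. ennreal (real (\<sigma> (n + i + 1)) / lin_interp w ((1/2 + \<epsilon>) * real (\<tau> (n + i)))))
          \<le> ennreal (1/4) * (\<Sum>i. ennreal (1 / w (nat \<lfloor>(1/2 - \<epsilon>) * real (\<tau> n)\<rfloor> + i)))"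
    using iii[OF \<epsilon>] by blast
  let ?l = "leads \<tau> (\<lambda>i. \<epsilon> * real (\<tau> i))"
  have \<tau>': "total_balls b0 r0 \<sigma> = \<tau>" by (simp add: \<tau>_def total_balls_commute)
  have AE_B: "AE \<omega> in M. (\<exists>N. \<forall>k\<ge>N. ?l R B k \<omega>) \<longrightarrow> (\<exists>K. \<forall>k. B k \<omega> \<le> K)"
    unfolding \<tau>_def by (rule red.minority_bounded[OF \<epsilon> summ]) (rule n0[unfolded \<tau>_def])
  have AE_R: "AE \<omega> in M. (\<exists>N. \<forall>k\<ge>N. ?l B R k \<omega>) \<longrightarrow> (\<exists>K. \<forall>k. R k \<omega> \<le> K)"
    unfolding \<tau>'[symmetric] by (rule blue.minority_bounded[OF \<epsilon> summ]) (rule n0[folded \<tau>'])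
  have AE_lead: "AE \<omega> in M. (\<exists>N. \<forall>k\<ge>N. ?l R B k \<omega>) \<or> (\<exists>N. \<forall>k\<ge>N. ?l B R k \<omega>)"
    unfolding \<tau>_def \<epsilon>_def by (rule one_colour_dominates[OF bias bias' i])
  have "AE \<omega> in M. final_count R \<omega> < \<infinity> \<or> final_count B \<omega> < \<infinity>"
    using AE_lead AE_B AE_R red.AE_mono blue.AE_mono
  proof eventually_elim
    case (elim \<omega>)
    then have "(\<exists>K. \<forall>k. B k \<omega> \<le> K) \<or> (\<exists>K. \<forall>k. R k \<omega> \<le> K)" by blast
    then show ?case
    proof (elim disjE exE)
      fix K assume "\<forall>k. B k \<omega> \<le> K"
      then show ?thesis using lim_enat_bounded[OF elim(5), of K] by (auto simp: final_count_def)
    next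
      fix K assume "\<forall>k. R k \<omega> \<le> K"
      then show ?thesis using lim_enat_bounded[OF elim(4), of K] by (auto simp: final_count_def)
    qed
  qed
  moreover have "{\<omega>\<in>space M. final_count R \<omega> < \<infinity> \<or> final_count B \<omega> < \<infinity>} \<in> red.events"
    using sets.Un[OF red.final_count_events blue.final_count_events]
    by (simp add: Collect_disj_eq[symmetric] conj_disj_distribL)
  ultimately show ?thesis by (subst red.prob_Collect_eq_1) auto
qed

end
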